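(* Let $X=\mathbb{C}^2/(\mathbb{Z}^2\oplus\sqrt{-1}\mathbb{Z}^2)$ with flat Kähler form $\omega_0=\sqrt{-1}\sum_idz_i\wedge d\bar z_i$, let $L$ be any holomorphic line bundle on $X$, and let $F^0=\sqrt{-1}\sum_{i,j}F^0_{ij}dz_i\wedge d\bar z_j$, where $\sqrt{-1}F^0$ is the constant-coefficient curvature form of a metric on $L$. Let $\alpha>0$. (1) (Large radius limit.) Let $c=\operatorname{tr}(F^0)$. For every smooth $\mathbb{Z}$-periodic function $A(x_1)$ of a single symplectic coordinate satisfying the necessary cohomological condition $\int_0^1A(x_1)dx_1=\alpha\left(4\det(F^0)+\frac12c^2\right)$, there are a $U(1)^2$-invariant Kähler form $\omega\in[\omega_0]$ and a Hermitian metric $h$ on $L$, with curvature $F(h)=\sqrt{-1}F$, solving the coupled Kähler–Yang–Mills equations $$\begin{cases}\Lambda_\omega F=c\\ s(\omega)+\alpha\left(\Lambda_\omega^2(F\wedge F)+\frac12c^2\right)=f,\end{cases}$$ with datum $f=f(y_1)$ given by $f(\nabla u(x))=A(x_1)$. (2) (Small radius limit.) Suppose $\det(F^0)>0$ and let $c=\operatorname{tr}(F^0)/\det(F^0)$. For every smooth $\mathbb{Z}$-periodic function $A(x_1)$ satisfying the necessary cohomological condition $\int_0^1A(x_1)dx_1=-\alpha\det(F^0)$, there are a $U(1)^2$-invariant Kähler form $\omega\in[\omega_0]$ and a Hermitian metric $h$ on $L$, with curvature $F(h)=\sqrt{-1}F$, solving the equations $$\begin{cases}\Lambda_F\omega=c\\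 s(\omega)-\alpha\,\dfrac{F^2}{\omega^2}=f,\end{cases}$$ with datum $f=f(y_1)$ given by $f(\nabla u(x))=A(x_1)$.
   Context: $U(1)^2$ acts by translations in the direction $\sqrt{-1}\mathbb{R}^2$. Write $y=\operatorname{Re}z$. An invariant Kähler form in $[\omega_0]$ is $\omega=\sqrt{-1}\sum v_{ij}(y)dz_i\wedge d\bar z_j$, with $v_{ij}$ the real Hessian of a convex function $v(y)=\frac12|y|^2+\psi(y)$, $\psi$ being $\mathbb{Z}^2$-periodic. The Legendre transform $u$ of $v$ (for the unknown $\omega$) is defined by $u(x)+v(y)=x\cdot y$, $x=\nabla v(y)$; it has the form $\frac12|x|^2+\phi(x)$ with $\phi$ periodic, and $y=\nabla u(x)$. The scalar curvature is $s(\omega)=-\frac14v^{ij}[\log\det(v_{ab})]_{ij}$. For $F=\sqrt{-1}\sum F_{ij}dz_i\wedge d\bar z_j$: $\Lambda_\omega F=v^{ij}F_{ij}$, $\Lambda^2_\omega(F\wedge F)=2(\Lambda_\omega F)^2-2v^{ij}v^{kl}F_{il}F_{kj}$, and (for $F$ nondegenerate) $\Lambda_F\omega=F^{ij}v_{ij}$ with $F^{ij}$ the inverse matrix, i.e. $\Lambda_F\omega=2\,\omega\wedge F/F^2$. *)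

theory Defs
  imports "HOL-Analysis.Analysis"
begin

section \<open>Calculus on open subsets of Euclidean spaces\<close>

(* k_smooth_on and smooth_on are only meant for open S. *)
primrec k_smooth_on ::
  "nat \<Rightarrow> 'a::real_normed_vector set \<Rightarrow> ('a \<Rightarrow> 'b::real_normed_vector) \<Rightarrow> bool" where
  "k_smooth_on 0 S f \<longleftrightarrow> continuous_on S f"
| "k_smooth_on (Suc k) S f \<longleftrightarrow>
     (\<forall>x\<in>S. f differentiable (at x)) \<and>
     (\<forall>v. k_smooth_on k S (\<lambda>x. frechet_derivative f (at x) v))"

definition smooth_on ::
  "'a::real_normed_vector set \<Rightarrow> ('a \<Rightarrow> 'b::real_normed_vector) \<Rightarrow> bool" where
  "smooth_on S f \<longleftrightarrow> (\<forall>k. k_smooth_on k S f)"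

definition dir_deriv ::
  "('a::real_normed_vector \<Rightarrow> 'b::real_normed_vector) \<Rightarrow> 'a \<Rightarrow> 'a \<Rightarrow> 'b" where
  "dir_deriv f x v = frechet_derivative f (at x) v"

definition grad :: "(real^2 \<Rightarrow> real) \<Rightarrow> real^2 \<Rightarrow> real^2" where
  "grad f x = (\<chi> i. dir_deriv f x (axis i 1))"

definition hess :: "(real^2 \<Rightarrow> real) \<Rightarrow> real^2 \<Rightarrow> real^2^2" where
  "hess f x = (\<chi> i j. dir_deriv (\<lambda>y. dir_deriv f y (axis j 1)) x (axis i 1))"

(* The Wirtinger operators d/dz_i and d/d(conj z_i). *)
definition wirt :: "2 \<Rightarrow> (complex^2 \<Rightarrow> complex) \<Rightarrow> complex^2 \<Rightarrow> complex" where
  "wirt i f z = (dir_deriv f z (axis i 1) - \<i> * dir_deriv f z (axis i \<i>)) / 2"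

definition wirt_bar :: "2 \<Rightarrow> (complex^2 \<Rightarrow> complex) \<Rightarrow> complex^2 \<Rightarrow> complex" where
  "wirt_bar i f z = (dir_deriv f z (axis i 1) + \<i> * dir_deriv f z (axis i \<i>)) / 2"

(* Holomorphy in two variables on an open set: a complex linear derivative at every point. *)
definition holomorphic2_on :: "(complex^2 \<Rightarrow> complex) \<Rightarrow> (complex^2) set \<Rightarrow> bool" where
  "holomorphic2_on g S \<longleftrightarrow>
     (\<forall>z\<in>S. \<exists>D. (g has_derivative D) (at z) \<and> (\<forall>c v. D (c *s v) = c * D v))"


section \<open>The complex torus\<close>

definition lattice :: "(complex^2) set" where
  "lattice = {l. \<forall>i. Re (l $ i) \<in> \<int> \<and> Im (l $ i) \<in> \<int>}"

(* Points of X are cosets of the lattice.  Functions, forms and open sets on X are described by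
   their pullbacks along torus_pt. *)
definition torus_pt :: "complex^2 \<Rightarrow> (complex^2) set" where
  "torus_pt z = {z + l | l. l \<in> lattice}"

definition torus :: "(complex^2) set set" where
  "torus = range torus_pt"

definition torus_open :: "(complex^2) set set \<Rightarrow> bool" where
  "torus_open U \<longleftrightarrow> U \<subseteq> torus \<and> open (torus_pt -` U)"


section \<open>Differential forms\<close>

(* Complex valued forms are evaluated on real tangent vectors: a 1-form is z |-> v |-> eta z v,
   a 2-form is z |-> v w |-> omega z v w, with (a /\ b)(v,w) = a(v) b(w) - a(w) b(v). *)
type_synonym form1 = "complex^2 \<Rightarrow> complex^2 \<Rightarrow> complex"
type_synonym form2 = "complex^2 \<Rightarrow> complex^2 \<Rightarrow> complex^2 \<Rightarrow> complex"

(* dz_i /\ d(conj z_j) *)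
definition dz_dzbar :: "2 \<Rightarrow> 2 \<Rightarrow> complex^2 \<Rightarrow> complex^2 \<Rightarrow> complex" where
  "dz_dzbar i j v w = v $ i * cnj (w $ j) - w $ i * cnj (v $ j)"

(* i * sum_{ij} G_ij dz_i /\ d(conj z_j) *)
definition form11 :: "(complex^2 \<Rightarrow> complex^2^2) \<Rightarrow> form2" where
  "form11 G z v w = \<i> * (\<Sum>i\<in>UNIV. \<Sum>j\<in>UNIV. G z $ i $ j * dz_dzbar i j v w)"

definition ext_deriv1 :: "form1 \<Rightarrow> form2" where
  "ext_deriv1 \<eta> z v w = dir_deriv (\<lambda>z. \<eta> z w) z v - dir_deriv (\<lambda>z. \<eta> z v) z w"

definition closed_form2 :: "form2 \<Rightarrow> bool" where
  "closed_form2 \<omega> \<longleftrightarrow>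
     (\<forall>z u v w. dir_deriv (\<lambda>z. \<omega> z v w) z u - dir_deriv (\<lambda>z. \<omega> z u w) z v
              + dir_deriv (\<lambda>z. \<omega> z u v) z w = 0)"

definition torus_form1 :: "form1 \<Rightarrow> bool" where
  "torus_form1 \<eta> \<longleftrightarrow>
     (\<forall>z. linear (\<eta> z)) \<and> (\<forall>v. smooth_on UNIV (\<lambda>z. \<eta> z v)) \<and>
     (\<forall>z. \<forall>l\<in>lattice. \<eta> (z + l) = \<eta> z)"

definition cohomologous :: "form2 \<Rightarrow> form2 \<Rightarrow> bool" where
  "cohomologous \<omega> \<omega>' \<longleftrightarrow>
     (\<exists>\<eta>. torus_form1 \<eta> \<and> (\<forall>z v w. \<omega> z v w - \<omega>' z v w = ext_deriv1 \<eta> z v w))"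

definition hermitian_pos_def :: "complex^2^2 \<Rightarrow> bool" where
  "hermitian_pos_def G \<longleftrightarrow>
     (\<forall>i j. G $ j $ i = cnj (G $ i $ j)) \<and>
     (\<forall>v. v \<noteq> 0 \<longrightarrow> Re (\<Sum>i\<in>UNIV. \<Sum>j\<in>UNIV. G $ i $ j * v $ i * cnj (v $ j)) > 0)"

definition kahler_form :: "form2 \<Rightarrow> bool" where
  "kahler_form \<omega> \<longleftrightarrow>
     (\<exists>G. \<omega> = form11 G \<and>
        (\<forall>i j. smooth_on UNIV (\<lambda>z. G z $ i $ j)) \<and>
        (\<forall>z. \<forall>l\<in>lattice. G (z + l) = G z) \<and>
        (\<forall>z. hermitian_pos_def (G z))) \<and>
     closed_form2 \<omega>"

definition flat_form :: form2 where
  "flat_form = form11 (\<lambda>_. mat 1)"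

(* Invariance under the action of U(1)^2 by translations in the imaginary directions. *)
definition U1_invariant :: "form2 \<Rightarrow> bool" where
  "U1_invariant \<omega> \<longleftrightarrow>
     (\<forall>(t::real^2) z. \<omega> (z + (\<chi> i. \<i> * complex_of_real (t $ i))) = \<omega> z)"

definition wedge22 :: "form2 \<Rightarrow> form2 \<Rightarrow> complex^2 \<Rightarrow>
    complex^2 \<Rightarrow> complex^2 \<Rightarrow> complex^2 \<Rightarrow> complex^2 \<Rightarrow> complex" where
  "wedge22 \<beta> \<gamma> z a b c d =
     \<beta> z a b * \<gamma> z c d - \<beta> z a c * \<gamma> z b d + \<beta> z a d * \<gamma> z b c
   + \<beta> z b c * \<gamma> z a d - \<beta> z b d * \<gamma> z a c + \<beta> z c d * \<gamma> z a b"

(* The function F^2 / omega^2.  A quotient of top degree forms can be computed on any real basis. *)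
definition top_quotient :: "form2 \<Rightarrow> form2 \<Rightarrow> complex^2 \<Rightarrow> complex" where
  "top_quotient F \<omega> z =
     wedge22 F F z (axis 1 1) (axis 1 \<i>) (axis 2 1) (axis 2 \<i>) /
     wedge22 \<omega> \<omega> z (axis 1 1) (axis 1 \<i>) (axis 2 1) (axis 2 \<i>)"


section \<open>Holomorphic line bundles and Hermitian metrics\<close>

(* A line bundle is a total space with a projection to X and an atlas of trivialisations
   triv a over chart a, each being a bijection of every fibre onto the complex numbers.  The linear
   structure of the fibres and the complex structure of the total space are those transported by
   the trivialisations. *)
record ('e, 'a) line_bundle =
  total :: "'e set"
  proj :: "'e \<Rightarrow> (complex^2) set"
  index :: "'a set"
  chart :: "'a \<Rightarrow> (complex^2) set set"
  triv :: "'a \<Rightarrow> 'e \<Rightarrow> complex"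

definition fibre :: "('e, 'a) line_bundle \<Rightarrow> (complex^2) set \<Rightarrow> 'e set" where
  "fibre L p = {e \<in> total L. proj L e = p}"

definition holomorphic_line_bundle :: "('e, 'a) line_bundle \<Rightarrow> bool" where
  "holomorphic_line_bundle L \<longleftrightarrow>
     proj L ` total L \<subseteq> torus \<and>
     (\<forall>a\<in>index L. torus_open (chart L a)) \<and>
     (\<Union>a\<in>index L. chart L a) = torus \<and>
     (\<forall>a\<in>index L. \<forall>p\<in>chart L a. bij_betw (triv L a) (fibre L p) UNIV) \<and>
     (\<forall>a\<in>index L. \<forall>b\<in>index L. \<exists>g.
        holomorphic2_on g (torus_pt -` (chart L a \<inter> chart L b)) \<and>
        (\<forall>z\<in>torus_pt -` (chart L a \<inter> chart L b). g z \<noteq> 0 \<and>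
           (\<forall>e\<in>fibre L (torus_pt z). triv L a e = g z * triv L b e)))"

(* A metric is given by its squared norm h on the total space; its local weight is the squared
   norm of the unit section of a trivialisation. *)
definition local_weight ::
  "('e, 'a) line_bundle \<Rightarrow> ('e \<Rightarrow> real) \<Rightarrow> 'a \<Rightarrow> complex^2 \<Rightarrow> real" where
  "local_weight L h a z = h (inv_into (fibre L (torus_pt z)) (triv L a) 1)"

definition hermitian_metric :: "('e, 'a) line_bundle \<Rightarrow> ('e \<Rightarrow> real) \<Rightarrow> bool" where
  "hermitian_metric L h \<longleftrightarrow>
     (\<forall>a\<in>index L.
        smooth_on (torus_pt -` chart L a) (local_weight L h a) \<and>
        (\<forall>z\<in>torus_pt -` chart L a. local_weight L h a z > 0 \<and>
           (\<forall>e\<in>fibre L (torus_pt z). h e = local_weight L h a z * (cmod (triv L a e))\<^sup>2)))"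

(* Curvature of the Chern connection: in each trivialisation it is
   dbar d log h_a = - d dbar log h_a, with h_a the local weight. *)
definition has_chern_curvature ::
  "('e, 'a) line_bundle \<Rightarrow> ('e \<Rightarrow> real) \<Rightarrow> form2 \<Rightarrow> bool" where
  "has_chern_curvature L h \<Theta> \<longleftrightarrow>
     (\<forall>a\<in>index L. \<forall>z\<in>torus_pt -` chart L a. \<forall>v w.
        \<Theta> z v w =
          - (\<Sum>i\<in>UNIV. \<Sum>j\<in>UNIV.
               wirt i (wirt_bar j (\<lambda>z. complex_of_real (ln (local_weight L h a z)))) z
               * dz_dzbar i j v w))"


section \<open>Invariant metrics and the terms of the equations\<close>

definition re_vec :: "complex^2 \<Rightarrow> real^2" where
  "re_vec z = (\<chi> i. Re (z $ i))"

definition cmat :: "real^2^2 \<Rightarrow> complex^2^2" where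
  "cmat V = (\<chi> i j. complex_of_real (V $ i $ j))"

definition invariant_potential :: "(real^2 \<Rightarrow> real) \<Rightarrow> bool" where
  "invariant_potential v \<longleftrightarrow> convex_on UNIV v \<and>
     (\<exists>\<psi>. smooth_on UNIV \<psi> \<and>
        (\<forall>y m. (\<forall>i. m $ i \<in> \<int>) \<longrightarrow> \<psi> (y + m) = \<psi> y) \<and>
        (\<forall>y. v y = (norm y)\<^sup>2 / 2 + \<psi> y))"

definition pot_matrix :: "(real^2 \<Rightarrow> real) \<Rightarrow> complex^2 \<Rightarrow> complex^2^2" where
  "pot_matrix v z = cmat (hess v (re_vec z))"

definition legendre :: "(real^2 \<Rightarrow> real) \<Rightarrow> real^2 \<Rightarrow> real" where
  "legendre v x = (let y = (THE y. grad v y = x) in x \<bullet> y - v y)"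

definition scalar_curvature :: "(real^2 \<Rightarrow> real) \<Rightarrow> real^2 \<Rightarrow> real" where
  "scalar_curvature v y =
     - (1/4) * (\<Sum>i\<in>UNIV. \<Sum>j\<in>UNIV.
        matrix_inv (hess v y) $ i $ j * hess (\<lambda>y. ln (det (hess v y))) y $ i $ j)"

(* G^{ij} F_ij with G^{ij} the inverse matrix of G.  The order of the indices of the inverse is
   immaterial as long as one of the two matrices is symmetric. *)
definition contraction :: "complex^2^2 \<Rightarrow> complex^2^2 \<Rightarrow> complex" where
  "contraction G F = (\<Sum>i\<in>UNIV. \<Sum>j\<in>UNIV. matrix_inv G $ i $ j * F $ i $ j)"

definition contraction2 :: "complex^2^2 \<Rightarrow> complex^2^2 \<Rightarrow> complex" where
  "contraction2 G F = 2 * (contraction G F)\<^sup>2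
     - 2 * (\<Sum>i\<in>UNIV. \<Sum>j\<in>UNIV. \<Sum>k\<in>UNIV. \<Sum>l\<in>UNIV.
          matrix_inv G $ i $ j * matrix_inv G $ k $ l * F $ i $ l * F $ k $ j)"

end

theory Submission
  imports Defs
begin

text \<open>
The solutions are found among potentials of the form
\<open>v(y) = y\<^sub>1\<^sup>2/2 + \<psi>(y\<^sub>1) + y\<^sub>2\<^sup>2/2\<close>. Their Hessian is diagonal with entries \<open>w\<close> and 1, where \<open>w\<close> depends on \<open>y\<^sub>1\<close> only, and their
Legendre transform splits in the same way. Write \<open>x\<^sub>1 = X(y\<^sub>1)\<close> for the first symplectic coordinate and
\<open>w = W(x\<^sub>1)\<close>. Then the scalar curvature is simply \<open>- W''(x\<^sub>1)/4\<close> (\<open>scalar_curvature_v\<close>).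

Multiplying the given metric on the line bundle by \<open>exp (4 k \<psi>(y\<^sub>1))\<close> adds \<open>k (w - 1)\<close> to the first diagonal entry of the
curvature and changes nothing else (\<open>metric_with_twisted_curvature\<close>). Let the constant curvature matrix have
diagonal entries \<open>a\<close>, \<open>d\<close>, off-diagonal entries of squared modulus \<open>n\<close>, and determinant \<open>D\<close>. The first equation of each
system is then an algebraic condition on \<open>k\<close>; it holds for \<open>k = a\<close> in the large radius limit and for
\<open>k = d D / (d\<^sup>2 + n)\<close> in the small radius limit (\<open>large_radius_terms\<close>, \<open>small_radius_terms\<close>). With these choices the second
equation becomes, in both limits, an ordinary differential equation in the symplectic coordinate,
\<open>W'' = \<kappa> (1 - 1/W) - 4 (A - mean of A)\<close>, with \<open>\<kappa> = 16 \<alpha> n\<close> or \<open>\<kappa> = 4 \<alpha> D n / (d\<^sup>2 + n)\<close>. The cohomological condition on \<open>A\<close> is exactly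
what makes the constants match. It remains to find a positive periodic solution \<open>W\<close> for which \<open>1/W\<close> has mean 1; the
mean condition says that \<open>X(y) - y\<close> is periodic, and \<open>\<psi>\<close> is recovered from \<open>W\<close> by \<open>inverse_profile\<close>.

For \<open>\<kappa> > 0\<close> the right hand side is increasing in \<open>W\<close>. After truncating \<open>1 - 1/W\<close> to a function with slopes between two
positive constants, the contraction principle gives a periodic solution (\<open>monotone_periodic_problem\<close>), since the
maximum principle bounds the resolvent of the second derivative on the circle. The maximum principle also
yields bounds above and below that show the truncation to be harmless (\<open>singular_periodic_problem\<close>), and the mean
condition follows by integrating the equation. For \<open>\<kappa> = 0\<close> the solution is determined up to an additive
constant, which is adjusted by the intermediate value theorem (\<open>linear_periodic_problem\<close>).
\<close>

section \<open>A calculus of smooth functions\<close>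

lemma k_smooth_on_cong:
  assumes "open S" "\<And>x. x \<in> S \<Longrightarrow> f x = g x" "k_smooth_on k S f"
  shows "k_smooth_on k S g"
  using assms(2,3)
proof (induction k arbitrary: f g)
  case 0
  then show ?case using continuous_on_cong[of S S f g] by simp
next
  case (Suc k)
  have D: "(g has_derivative frechet_derivative f (at x)) (at x)" if "x \<in> S" for x
  proof -
    have "(f has_derivative frechet_derivative f (at x)) (at x)"
      using Suc.prems that by (simp add: frechet_derivative_works)
    then show ?thesis
      by (rule has_derivative_transform_within_open[OF _ assms(1) that]) (use Suc.prems in auto)
  qed
  have eq: "frechet_derivative f (at x) = frechet_derivative g (at x)" if "x \<in> S" for x
    using D[OF that] by (rule frechet_derivative_at)
  have "k_smooth_on k S (\<lambda>x. frechet_derivative g (at x) v)" for v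
    by (rule Suc.IH[of "\<lambda>x. frechet_derivative f (at x) v"]) (use Suc.prems(2) in \<open>simp_all add: eq\<close>)
  then show ?case
    using D by (auto simp: differentiable_def)
qed

lemma smooth_on_cong:
  assumes "open S" "\<And>x. x \<in> S \<Longrightarrow> f x = g x" "smooth_on S f"
  shows "smooth_on S g"
  using assms k_smooth_on_cong unfolding smooth_on_def by blast

text \<open>Smoothness asks for derivatives of every order, so it is awkward to verify one derivative at a time.
If the derivatives of all generators stay in the algebra that they generate, then so do all
iterated derivatives. Generators may be any functions whose derivatives are polynomial in functions
already known, for instance the solution of a differential equation.\<close>

inductive_set fun_algebra :: "('a \<Rightarrow> real) set \<Rightarrow> ('a \<Rightarrow> real) set" for G where
  gen: "g \<in> G \<Longrightarrow> g \<in> fun_algebra G"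
| const: "(\<lambda>_. c) \<in> fun_algebra G"
| add: "f \<in> fun_algebra G \<Longrightarrow> g \<in> fun_algebra G \<Longrightarrow> (\<lambda>x. f x + g x) \<in> fun_algebra G"
| mult: "f \<in> fun_algebra G \<Longrightarrow> g \<in> fun_algebra G \<Longrightarrow> (\<lambda>x. f x * g x) \<in> fun_algebra G"

lemma fun_algebra_derivative:
  fixes G :: "('a::real_normed_vector \<Rightarrow> real) set"
  assumes G: "\<And>g. g \<in> G \<Longrightarrow>
      \<exists>D. (\<forall>x\<in>S. (g has_derivative D x) (at x)) \<and> (\<forall>v. (\<lambda>x. D x v) \<in> fun_algebra G)"
    and f: "f \<in> fun_algebra G"
  shows "\<exists>D. (\<forall>x\<in>S. (f has_derivative D x) (at x)) \<and> (\<forall>v. (\<lambda>x. D x v) \<in> fun_algebra G)"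
  using f
proof induction
  case (gen g)
  then show ?case by (rule G)
next
  case (const c)
  show ?case by (rule exI[of _ "\<lambda>x v. 0"]) (auto intro: fun_algebra.const)
next
  case (add f g)
  then obtain D E where
    "\<forall>x\<in>S. (f has_derivative D x) (at x)" "\<forall>v. (\<lambda>x. D x v) \<in> fun_algebra G"
    "\<forall>x\<in>S. (g has_derivative E x) (at x)" "\<forall>v. (\<lambda>x. E x v) \<in> fun_algebra G" by blast
  then show ?case
    by (intro exI[of _ "\<lambda>x v. D x v + E x v"]) (auto intro!: fun_algebra.add has_derivative_add)
next
  case (mult f g)
  then obtain D E where
    "\<forall>x\<in>S. (f has_derivative D x) (at x)" "\<forall>v. (\<lambda>x. D x v) \<in> fun_algebra G"
    "\<forall>x\<in>S. (g has_derivative E x) (at x)" "\<forall>v. (\<lambda>x. E x v) \<in> fun_algebra G" by blast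
  with mult show ?case
    by (intro exI[of _ "\<lambda>x v. f x * E x v + D x v * g x"])
       (auto intro!: fun_algebra.add fun_algebra.mult has_derivative_mult)
qed

lemma fun_algebra_smooth:
  fixes G :: "('a::real_normed_vector \<Rightarrow> real) set"
  assumes S: "open S"
    and G: "\<And>g. g \<in> G \<Longrightarrow>
      \<exists>D. (\<forall>x\<in>S. (g has_derivative D x) (at x)) \<and> (\<forall>v. (\<lambda>x. D x v) \<in> fun_algebra G)"
    and f: "f \<in> fun_algebra G"
  shows "smooth_on S f"
proof -
  have "k_smooth_on k S f" for k
    using f
  proof (induction k arbitrary: f)
    case 0
    obtain D where "\<forall>x\<in>S. (f has_derivative D x) (at x)"
      using fun_algebra_derivative[OF G 0] by blast
    then show ?case
      by (auto intro!: continuous_at_imp_continuous_on dest: has_derivative_continuous)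
  next
    case (Suc k)
    obtain D where D: "\<And>x. x \<in> S \<Longrightarrow> (f has_derivative D x) (at x)"
        and alg: "\<And>v. (\<lambda>x. D x v) \<in> fun_algebra G"
      using fun_algebra_derivative[OF G Suc.prems] by blast
    have "k_smooth_on k S (\<lambda>x. frechet_derivative f (at x) v)" for v
      by (rule k_smooth_on_cong[OF S _ Suc.IH[OF alg[of v]]]) (use D frechet_derivative_at in metis)
    then show ?case using D by (auto simp: differentiable_def)
  qed
  then show ?thesis by (simp add: smooth_on_def)
qed

lemma smooth_on_frechet:
  assumes "smooth_on S f"
  shows "smooth_on S (\<lambda>x. frechet_derivative f (at x) v)"
    "x \<in> S \<Longrightarrow> (f has_derivative frechet_derivative f (at x)) (at x)"
    "continuous_on S f"
proof -
  have *: "k_smooth_on k S f" for k using assms by (simp add: smooth_on_def)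
  show "smooth_on S (\<lambda>x. frechet_derivative f (at x) v)"
    using *[of "Suc _"] by (auto simp: smooth_on_def)
  show "x \<in> S \<Longrightarrow> (f has_derivative frechet_derivative f (at x)) (at x)"
    using *[of 1] by (auto simp: frechet_derivative_works)
  show "continuous_on S f" using *[of 0] by simp
qed

text \<open>Functions already known to be smooth can be added to the generators for free; new functions are then
smooth as soon as their first derivatives are polynomial in the new and the known ones. The product
rule and the chain rule for smooth functions are instances.\<close>

lemma smooth_on_fun_algebra_insert:
  fixes G :: "('a::real_normed_vector \<Rightarrow> real) set"
  assumes S: "open S"
    and G: "\<And>g. g \<in> G \<Longrightarrow> \<exists>D. (\<forall>x\<in>S. (g has_derivative D x) (at x)) \<and>
        (\<forall>v. (\<lambda>x. D x v) \<in> fun_algebra (G \<union> {f. smooth_on S f}))"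
    and f: "f \<in> fun_algebra (G \<union> {f. smooth_on S f})"
  shows "smooth_on S f"
proof (rule fun_algebra_smooth[OF S _ f])
  fix g assume g: "g \<in> G \<union> {f. smooth_on S f}"
  show "\<exists>D. (\<forall>x\<in>S. (g has_derivative D x) (at x)) \<and>
        (\<forall>v. (\<lambda>x. D x v) \<in> fun_algebra (G \<union> {f. smooth_on S f}))"
  proof (cases "g \<in> G")
    case False
    with g have "smooth_on S g" by simp
    then show ?thesis
      by (intro exI[of _ "\<lambda>x. frechet_derivative g (at x)"])
        (auto intro: smooth_on_frechet fun_algebra.gen)
  qed (rule G)
qed

lemma smooth_on_add:
  fixes f g :: "'a::real_normed_vector \<Rightarrow> real"
  assumes "open S" "smooth_on S f" "smooth_on S g"
  shows "smooth_on S (\<lambda>x. f x + g x)"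
  by (rule smooth_on_fun_algebra_insert[where G = "{}"])
    (use assms in \<open>auto intro: fun_algebra.add[OF fun_algebra.gen fun_algebra.gen]\<close>)

lemma smooth_on_mult:
  fixes f g :: "'a::real_normed_vector \<Rightarrow> real"
  assumes "open S" "smooth_on S f" "smooth_on S g"
  shows "smooth_on S (\<lambda>x. f x * g x)"
  by (rule smooth_on_fun_algebra_insert[where G = "{}"])
    (use assms in \<open>auto intro: fun_algebra.mult[OF fun_algebra.gen fun_algebra.gen]\<close>)

lemma smooth_on_const:
  fixes c :: real
  assumes "open S"
  shows "smooth_on S (\<lambda>_. c)"
  by (rule smooth_on_fun_algebra_insert[where G = "{}"])
    (use assms in \<open>auto intro!: fun_algebra.const\<close>)

lemma smooth_on_bounded_linear:
  fixes l :: "'a::real_normed_vector \<Rightarrow> real"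
  assumes "bounded_linear l" "open S"
  shows "smooth_on S l"
  by (rule fun_algebra_smooth[where G = "{l}"])
    (use assms in \<open>auto intro!: fun_algebra.const fun_algebra.gen exI[of _ "\<lambda>x. l"]
       bounded_linear_imp_has_derivative\<close>)

text \<open>The right family of generators consists of all \<^term>\<open>\<lambda>x. g (f x)\<close> at once, since differentiating replaces
\<open>g\<close> by \<open>g'\<close>.\<close>

lemma smooth_on_compose:
  fixes g :: "real \<Rightarrow> real" and f :: "'a::real_normed_vector \<Rightarrow> real"
  assumes S: "open S" and f: "smooth_on S f" and g: "smooth_on T g" and T: "f ` S \<subseteq> T"
  shows "smooth_on S (\<lambda>x. g (f x))"
proof (rule smooth_on_fun_algebra_insert[where G = "{\<lambda>x. g (f x) | g. smooth_on T g}"])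
  fix h :: "'a \<Rightarrow> real" assume "h \<in> {\<lambda>x. g (f x) | g. smooth_on T g}"
  then obtain g :: "real \<Rightarrow> real" where h: "h = (\<lambda>x. g (f x))" and g: "smooth_on T g" by blast
  let ?D = "\<lambda>x v. frechet_derivative g (at (f x)) 1 * frechet_derivative f (at x) v"
  have D: "(h has_derivative ?D x) (at x)" if x: "x \<in> S" for x
  proof -
    have gd: "(g has_derivative frechet_derivative g (at (f x))) (at (f x))"
      using smooth_on_frechet(2)[OF g] x T by auto
    have "(h has_derivative (\<lambda>v. frechet_derivative g (at (f x)) (frechet_derivative f (at x) v))) (at x)"
      unfolding h
      by (rule has_derivative_compose[OF smooth_on_frechet(2)[OF f x] gd])
    moreover have "frechet_derivative g (at (f x)) t = frechet_derivative g (at (f x)) 1 * t" for t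
      using linear_scale[OF has_derivative_linear[OF gd], of t 1] by (simp add: mult.commute)
    then have "(\<lambda>v. frechet_derivative g (at (f x)) (frechet_derivative f (at x) v)) = ?D x" by blast
    ultimately show ?thesis by simp
  qed
  have "(\<lambda>x. ?D x v) \<in> fun_algebra ({\<lambda>x. g (f x) | g. smooth_on T g} \<union> {f. smooth_on S f})" for v
  proof (rule fun_algebra.mult[OF fun_algebra.gen fun_algebra.gen, OF UnI1 UnI2])
    have "smooth_on T (\<lambda>y. frechet_derivative g (at y) 1)" by (rule smooth_on_frechet(1)[OF g])
    then show "(\<lambda>x. frechet_derivative g (at (f x)) 1) \<in> {\<lambda>x. g (f x) | g. smooth_on T g}"
      by (intro CollectI exI[of _ "\<lambda>y. frechet_derivative g (at y) 1"] conjI refl)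
    show "(\<lambda>x. frechet_derivative f (at x) v) \<in> {f. smooth_on S f}"
      using smooth_on_frechet(1)[OF f] by simp
  qed
  then show "\<exists>D. (\<forall>x\<in>S. (h has_derivative D x) (at x)) \<and>
        (\<forall>v. (\<lambda>x. D x v) \<in> fun_algebra ({\<lambda>x. g (f x) | g. smooth_on T g} \<union> {f. smooth_on S f}))"
    using D by (intro exI[of _ ?D]) simp
qed (use S g in \<open>auto intro: fun_algebra.gen\<close>)

lemma smooth_on_of_real:
  fixes f :: "'a::real_normed_vector \<Rightarrow> real"
  assumes "smooth_on S f" "open S"
  shows "smooth_on S (\<lambda>x. of_real (f x) :: complex)"
proof -
  have "k_smooth_on k S f \<Longrightarrow> k_smooth_on k S (\<lambda>x. of_real (f x) :: complex)" for k
  proof (induction k arbitrary: f)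
    case (Suc k)
    have D: "((\<lambda>x. of_real (f x) :: complex) has_derivative (\<lambda>v. of_real (frechet_derivative f (at x) v))) (at x)"
      if "x \<in> S" for x
      using Suc.prems that
      by (intro has_derivative_of_real) (simp add: frechet_derivative_works)
    have "k_smooth_on k S (\<lambda>x. frechet_derivative (\<lambda>x. of_real (f x) :: complex) (at x) v)" for v
    proof (rule k_smooth_on_cong[OF assms(2)])
      show "k_smooth_on k S (\<lambda>x. of_real (frechet_derivative f (at x) v) :: complex)"
        using Suc.prems by (intro Suc.IH) simp
      show "of_real (frechet_derivative f (at x) v) =
          frechet_derivative (\<lambda>x. of_real (f x) :: complex) (at x) v" if "x \<in> S" for x
        using frechet_derivative_at[OF D[OF that]] by metis
    qed
    then show ?case using D by (auto simp: differentiable_def)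
  qed (auto intro: continuous_on_of_real)
  then show ?thesis using assms by (simp add: smooth_on_def)
qed

lemma smooth_on_deriv:
  fixes f :: "real \<Rightarrow> real"
  assumes "smooth_on UNIV f"
  shows "smooth_on UNIV (deriv f)" "(f has_real_derivative deriv f x) (at x)"
proof -
  have D: "(f has_real_derivative frechet_derivative f (at x) 1) (at x)" for x
  proof -
    have gd: "(f has_derivative frechet_derivative f (at x)) (at x)"
      using smooth_on_frechet(2)[OF assms] by simp
    have "frechet_derivative f (at x) t = frechet_derivative f (at x) 1 * t" for t
      using linear_scale[OF has_derivative_linear[OF gd], of t 1] by (simp add: mult.commute)
    then have "frechet_derivative f (at x) = (*) (frechet_derivative f (at x) 1)" by blast
    then show ?thesis using gd unfolding has_field_derivative_def by simp
  qed
  then have "deriv f = (\<lambda>x. frechet_derivative f (at x) 1)"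
    by (auto intro: DERIV_imp_deriv)
  then show "smooth_on UNIV (deriv f)" "(f has_real_derivative deriv f x) (at x)"
    using D smooth_on_frechet(1)[OF assms] by metis+
qed

lemma smooth_on_real_generated:
  fixes G :: "(real \<Rightarrow> real) set"
  assumes G: "\<And>g. g \<in> G \<Longrightarrow> \<exists>D \<in> fun_algebra (G \<union> {f. smooth_on UNIV f}).
      \<forall>x. (g has_real_derivative D x) (at x)"
    and f: "f \<in> fun_algebra (G \<union> {f. smooth_on UNIV f})"
  shows "smooth_on UNIV f"
proof (rule smooth_on_fun_algebra_insert[OF _ _ f])
  fix g assume "g \<in> G"
  then obtain D where D: "D \<in> fun_algebra (G \<union> {f. smooth_on UNIV f})"
      "\<And>x. (g has_real_derivative D x) (at x)"
    using G by blast
  have "(\<lambda>x. D x * v) \<in> fun_algebra (G \<union> {f. smooth_on UNIV f})" for v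
    using D(1) by (rule fun_algebra.mult) (rule fun_algebra.const)
  then show "\<exists>D. (\<forall>x\<in>UNIV. (g has_derivative D x) (at x)) \<and>
        (\<forall>v. (\<lambda>x. D x v) \<in> fun_algebra (G \<union> {f. smooth_on UNIV f}))"
    using D(2) by (intro exI[of _ "\<lambda>x v. D x * v"]) (auto simp: has_field_derivative_def)
qed simp

lemma smooth_on_primitive:
  fixes f g :: "real \<Rightarrow> real"
  assumes "smooth_on UNIV g" "\<And>x. (f has_real_derivative g x) (at x)"
  shows "smooth_on UNIV f"
  by (rule smooth_on_real_generated[of "{f}"]) (use assms in \<open>auto intro: fun_algebra.gen\<close>)

lemma smooth_on_exp: "smooth_on UNIV (exp :: real \<Rightarrow> real)"
  by (rule smooth_on_real_generated[of "{exp}"]) (auto intro: fun_algebra.gen DERIV_exp bexI[of _ exp])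

text \<open>Regularity for an autonomous equation: \<open>(h \<circ> f)' = (h' \<circ> f) (g \<circ> f)\<close>, so the compositions with \<open>f\<close> form a
family closed under differentiation.\<close>

lemma smooth_on_ODE:
  fixes f g :: "real \<Rightarrow> real"
  assumes "smooth_on UNIV g" "\<And>x. (f has_real_derivative g (f x)) (at x)"
  shows "smooth_on UNIV f"
proof (rule smooth_on_real_generated[of "{\<lambda>x. h (f x) | h. smooth_on UNIV h}"])
  fix k :: "real \<Rightarrow> real" assume "k \<in> {\<lambda>x. h (f x) | h. smooth_on UNIV h}"
  then obtain h :: "real \<Rightarrow> real" where h: "smooth_on UNIV h" "k = (\<lambda>x. h (f x))" by blast
  have "(k has_real_derivative deriv h (f x) * g (f x)) (at x)" for x
    unfolding h(2) using DERIV_chain2[OF smooth_on_deriv(2)[OF h(1)] assms(2)] .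
  note D = this
  have A: "(\<lambda>x. deriv h (f x) * g (f x))
      \<in> fun_algebra ({\<lambda>x. h (f x) | h. smooth_on UNIV h} \<union> {f. smooth_on UNIV f})"
  proof (rule fun_algebra.mult[OF fun_algebra.gen fun_algebra.gen, OF UnI1 UnI1])
    show "(\<lambda>x. deriv h (f x)) \<in> {\<lambda>x. h (f x) | h. smooth_on UNIV h}"
      using smooth_on_deriv(1)[OF h(1)] by (intro CollectI exI[of _ "deriv h"] conjI refl)
    show "(\<lambda>x. g (f x)) \<in> {\<lambda>x. h (f x) | h. smooth_on UNIV h}"
      using assms(1) by (intro CollectI exI[of _ g] conjI refl)
  qed
  show "\<exists>D \<in> fun_algebra ({\<lambda>x. h (f x) | h. smooth_on UNIV h} \<union> {f. smooth_on UNIV f}).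
      \<forall>x. (k has_real_derivative D x) (at x)"
    using D by (intro bexI[OF _ A]) simp
next
  have "smooth_on UNIV (\<lambda>x::real. x)"
    by (rule smooth_on_bounded_linear) auto
  then show "f \<in> fun_algebra ({\<lambda>x. h (f x) | h. smooth_on UNIV h} \<union> {f. smooth_on UNIV f})"
    by (intro fun_algebra.gen UnI1) force
qed

text \<open>Regularity for \<open>W'' = \<kappa> (1 - 1/W) - B\<close>: the functions \<open>W\<close>, \<open>W'\<close> and \<open>1/W\<close> generate, over the smooth functions,
an algebra closed under differentiation, because \<open>(1/W)' = - W' (1/W)\<^sup>2\<close>.\<close>

lemma smooth_on_singular_ODE:
  fixes W V B :: "real \<Rightarrow> real"
  assumes B: "smooth_on UNIV B" and pos: "\<And>x. W x > 0"
    and W: "\<And>x. (W has_real_derivative V x) (at x)"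
    and V: "\<And>x. (V has_real_derivative \<kappa> * (1 - 1 / W x) - B x) (at x)"
  shows "smooth_on UNIV W"
proof -
  let ?G = "{W, V, \<lambda>x. 1 / W x}"
  let ?A = "fun_algebra (?G \<union> {f. smooth_on UNIV f})"
  have gen: "W \<in> ?A" "V \<in> ?A" "(\<lambda>x. 1 / W x) \<in> ?A" "B \<in> ?A"
    using B by (auto intro: fun_algebra.gen)
  have V': "(\<lambda>x. \<kappa> * (1 + (-1) * (1 / W x)) + (-1) * B x) \<in> ?A"
    by (intro fun_algebra.add fun_algebra.mult fun_algebra.const gen)
  have R': "(\<lambda>x. (-1) * V x * ((1 / W x) * (1 / W x))) \<in> ?A"
    by (intro fun_algebra.add fun_algebra.mult fun_algebra.const gen)
  have R: "((\<lambda>x. 1 / W x) has_real_derivative (-1) * V x * ((1 / W x) * (1 / W x))) (at x)" for x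
    using pos[of x] by (auto intro!: derivative_eq_intros W simp: field_simps)
  have D: "\<exists>D \<in> ?A. \<forall>x. (g has_real_derivative D x) (at x)" if "g \<in> ?G" for g
  proof -
    consider "g = W" | "g = V" | "g = (\<lambda>x. 1 / W x)" using \<open>g \<in> ?G\<close> by blast
    then show ?thesis
    proof cases
      case 1 then show ?thesis using W gen by blast
    next
      case 2
      have "\<kappa> * (1 + (-1) * (1 / W x)) + (-1) * B x = \<kappa> * (1 - 1 / W x) - B x" for x by simp
      then show ?thesis using V unfolding 2 by (intro bexI[OF _ V']) simp
    next
      case 3 then show ?thesis using R by (intro bexI[OF _ R']) simp
    qed
  qed
  show "smooth_on UNIV W"
    by (rule smooth_on_real_generated[OF D gen(1)])
qed

section \<open>Periodic functions and the maximum principle\<close>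

lemma periodic_of_int:
  assumes "\<And>x::real. f (x + 1) = f x"
  shows "f (x + of_int n) = f x"
proof -
  have nat: "f (x + real k) = f x" for k x
  proof (induction k)
    case (Suc k)
    then show ?case using assms[of "x + real k"] by (simp add: algebra_simps)
  qed simp
  show ?thesis
    using nat[of x "nat n"] nat[of "x + of_int n" "nat (-n)"] by (cases "n \<ge> 0") auto
qed

lemma periodic_attains_max:
  fixes f :: "real \<Rightarrow> real"
  assumes per: "\<And>x. f (x + 1) = f x" and "continuous_on UNIV f"
  obtains x\<^sub>0 where "x\<^sub>0 \<in> {0..1}" "\<And>x. f x \<le> f x\<^sub>0"
proof -
  obtain x0 where x0: "x0 \<in> {0..1}" "\<And>y. y \<in> {0..1} \<Longrightarrow> f y \<le> f x0"
    using continuous_attains_sup[of "{0..1::real}" f] continuous_on_subset[OF assms(2), of "{0..1}"]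
    by fastforce
  have "f x \<le> f x0" for x
  proof -
    have "f x = f (frac x)"
      using periodic_of_int[of f "x" "- \<lfloor>x\<rfloor>"] per by (simp add: frac_def)
    also have "\<dots> \<le> f x0" using frac_lt_1[of x] by (intro x0(2)) simp
    finally show ?thesis .
  qed
  then show ?thesis using x0(1) that by blast
qed

lemma periodic_attains_min:
  fixes f :: "real \<Rightarrow> real"
  assumes "\<And>x. f (x + 1) = f x" "continuous_on UNIV f"
  obtains x\<^sub>0 where "x\<^sub>0 \<in> {0..1}" "\<And>x. f x\<^sub>0 \<le> f x"
proof (rule periodic_attains_max[of "\<lambda>x. - f x"])
  show "continuous_on UNIV (\<lambda>x. - f x)" using assms(2) by (intro continuous_intros)
qed (use assms that in auto)

lemma periodic_bounded:
  fixes f :: "real \<Rightarrow> real"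
  assumes "\<And>x. f (x + 1) = f x" "continuous_on UNIV f"
  obtains b where "b > 0" "\<And>x. \<bar>f x\<bar> \<le> b"
proof (rule periodic_attains_max[of "\<lambda>x. \<bar>f x\<bar>"])
  show "continuous_on UNIV (\<lambda>x. \<bar>f x\<bar>)" using assms(2) by (intro continuous_intros)
  fix x0 assume "\<And>x. \<bar>f x\<bar> \<le> \<bar>f x0\<bar>"
  then show thesis by (intro that[of "\<bar>f x0\<bar> + 1"]) (auto intro: add_increasing2)
qed (use assms in auto)

lemma second_derivative_at_max:
  fixes f f' :: "real \<Rightarrow> real"
  assumes f: "\<And>x. (f has_real_derivative f' x) (at x)"
    and f': "(f' has_real_derivative d) (at x\<^sub>0)"
    and max: "\<And>x. f x \<le> f x\<^sub>0"
  shows "f' x\<^sub>0 = 0" "d \<le> 0"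
proof -
  show 0: "f' x\<^sub>0 = 0"
    using DERIV_local_max[OF f, of 1 x\<^sub>0] max by auto
  show "d \<le> 0"
  proof (rule ccontr)
    assume "\<not> d \<le> 0"
    then obtain e where e: "e > 0" "\<And>h. 0 < h \<Longrightarrow> h < e \<Longrightarrow> f' x\<^sub>0 < f' (x\<^sub>0 + h)"
      using DERIV_pos_inc_right[OF f'] by auto
    have "f x\<^sub>0 < f (x\<^sub>0 + e / 2)"
    proof -
      obtain z where "z > x\<^sub>0" "z < x\<^sub>0 + e / 2"
        "f (x\<^sub>0 + e / 2) - f x\<^sub>0 = (x\<^sub>0 + e / 2 - x\<^sub>0) * f' z"
        using MVT2[of x\<^sub>0 "x\<^sub>0 + e / 2" f f'] f e(1) by auto
      moreover have "f' z > 0"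
        using e(2)[of "z - x\<^sub>0"] calculation(1,2) e(1) 0 by simp
      ultimately have "f (x\<^sub>0 + e / 2) - f x\<^sub>0 = e / 2 * f' z" "0 < e / 2 * f' z" using e(1) by auto
      then show ?thesis by linarith
    qed
    then show False using max[of "x\<^sub>0 + e / 2"] by simp
  qed
qed

lemma second_derivative_at_min:
  fixes f f' :: "real \<Rightarrow> real"
  assumes f: "\<And>x. (f has_real_derivative f' x) (at x)"
    and f': "(f' has_real_derivative d) (at x\<^sub>0)"
    and min: "\<And>x. f x\<^sub>0 \<le> f x"
  shows "f' x\<^sub>0 = 0" "d \<ge> 0"
  using second_derivative_at_max[of "\<lambda>x. - f x" "\<lambda>x. - f' x" "- d" x\<^sub>0] assms
  by (auto intro: DERIV_minus)

lemma continuous_on_deriv: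
  fixes f f' :: "real \<Rightarrow> real"
  assumes "\<And>x. (f has_real_derivative f' x) (at x)"
  shows "continuous_on A f"
  using assms by (auto intro!: continuous_at_imp_continuous_on DERIV_isCont)

lemma exists_primitive:
  fixes h :: "real \<Rightarrow> real"
  assumes "continuous_on UNIV h"
  obtains H where "\<And>x. (H has_real_derivative h x) (at x)"
proof -
  have "\<exists>H. \<forall>x::real. - \<infinity> < ereal x \<longrightarrow> ereal x < \<infinity> \<longrightarrow> (H has_vector_derivative h x) (at x)"
    by (rule einterval_antiderivative) (use assms in \<open>auto simp: continuous_on_eq_continuous_at\<close>)
  then show ?thesis
    using that by (auto simp: has_real_derivative_iff_has_vector_derivative)
qed

lemma integral_of_derivative:
  fixes H h :: "real \<Rightarrow> real"
  assumes "\<And>x. (H has_real_derivative h x) (at x)" "a \<le> b"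
  shows "(h has_integral H b - H a) {a..b}"
  using assms
  by (intro fundamental_theorem_of_calculus)
    (auto simp: has_real_derivative_iff_has_vector_derivative intro: has_vector_derivative_at_within)

text \<open>The primitive is normalised to have mean zero so that the construction can be iterated.\<close>

lemma periodic_primitive:
  fixes h :: "real \<Rightarrow> real"
  assumes per: "\<And>x. h (x + 1) = h x" and cont: "continuous_on UNIV h"
    and mean: "integral {0..1} h = 0"
  obtains H where "\<And>x. (H has_real_derivative h x) (at x)" "\<And>x. H (x + 1) = H x"
    "integral {0..1} H = 0"
proof -
  obtain H0 where H0: "\<And>x. (H0 has_real_derivative h x) (at x)"
    using exists_primitive[OF cont] by blast
  define H where "H x = H0 x - integral {0..1} H0" for x
  have H: "(H has_real_derivative h x) (at x)" for x
    unfolding H_def using H0 by (auto intro!: derivative_eq_intros)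
  have "((\<lambda>x. H (x + 1) - H x) has_real_derivative h (x + 1) - h x) (at x)" for x
    by (intro derivative_intros H) (use H[of "x + 1"] in \<open>simp add: DERIV_shift\<close>)
  then have "H (x + 1) - H x = H (0 + 1) - H 0" for x
    using DERIV_isconst_all[of "\<lambda>x. H (x + 1) - H x" x 0] by (simp add: per)
  moreover have "H 1 - H 0 = 0"
    using integral_of_derivative[of H h 0 1, OF H] mean by (simp add: has_integral_iff)
  ultimately have "H (x + 1) = H x" for x by simp
  moreover have "integral {0..1} H = 0"
    unfolding H_def using continuous_on_deriv[OF H0, of "{0..1}"]
    by (subst integral_diff) (auto intro: integrable_continuous_real)
  ultimately show ?thesis using H that by blast
qed

section \<open>The periodic resolvent of the second derivative\<close>

text \<open>Variation of constants; the constant of integration is fixed by periodicity, which is possible since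
\<^term>\<open>exp \<mu> \<noteq> 1\<close>.\<close>

lemma first_order_periodic:
  fixes h :: "real \<Rightarrow> real"
  assumes per: "\<And>x. h (x + 1) = h x" and cont: "continuous_on UNIV h" and mu: "\<mu> \<noteq> 0"
  obtains Y where "\<And>x. (Y has_real_derivative h x - \<mu> * Y x) (at x)" "\<And>x. Y (x + 1) = Y x"
proof -
  have "continuous_on UNIV (\<lambda>x. exp (\<mu> * x) * h x)" using cont by (intro continuous_intros)
  then obtain K where K: "\<And>x. (K has_real_derivative exp (\<mu> * x) * h x) (at x)"
    using exists_primitive by blast
  have "((\<lambda>x. K (x + 1) - exp \<mu> * K x) has_real_derivative
      exp (\<mu> * (x + 1)) * h (x + 1) - exp \<mu> * (exp (\<mu> * x) * h x)) (at x)" for x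
    using K[of "x + 1"] K[of x] by (auto intro!: derivative_eq_intros simp: DERIV_shift)
  then have "K (x + 1) - exp \<mu> * K x = K (0 + 1) - exp \<mu> * K 0" for x
    using DERIV_isconst_all[of "\<lambda>x. K (x + 1) - exp \<mu> * K x" x 0]
    by (simp add: per distrib_left exp_add)
  then obtain k where k: "\<And>x. K (x + 1) = exp \<mu> * K x + k"
    by (metis add.commute diff_add_cancel)
  define c where "c = k / (exp \<mu> - 1)"
  have c: "k + c = exp \<mu> * c" using mu by (simp add: c_def field_simps)
  define Y where "Y x = exp (- \<mu> * x) * (K x + c)" for x
  have "(Y has_real_derivative h x - \<mu> * Y x) (at x)" for x
  proof -
    have "(Y has_real_derivative
        exp (- \<mu> * x) * (exp (\<mu> * x) * h x) + (- \<mu>) * exp (- \<mu> * x) * (K x + c)) (at x)"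
      unfolding Y_def by (auto intro!: derivative_eq_intros K)
    moreover have e: "exp (- \<mu> * x) * (exp (\<mu> * x) * h x) = h x"
      by (simp add: mult.assoc[symmetric] exp_add[symmetric])
    have "exp (- \<mu> * x) * (exp (\<mu> * x) * h x) + (- \<mu>) * exp (- \<mu> * x) * (K x + c) = h x - \<mu> * Y x"
      unfolding e Y_def by simp
    ultimately show ?thesis by metis
  qed
  moreover have "Y (x + 1) = Y x" for x
  proof -
    have "exp (- \<mu> * (x + 1)) = exp (- \<mu> * x) * exp (- \<mu>)"
      by (simp add: exp_add[symmetric] algebra_simps)
    then have "Y (x + 1) = exp (- \<mu> * x) * exp (- \<mu>) * (exp \<mu> * K x + (k + c))"
      unfolding Y_def k by simp
    also have "\<dots> = exp (- \<mu> * x) * (exp (- \<mu>) * exp \<mu>) * (K x + c)"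
      by (simp only: c) (simp add: algebra_simps)
    finally show ?thesis by (simp add: Y_def exp_add[symmetric])
  qed
  ultimately show ?thesis using that by blast
qed

text \<open>The operator \<open>\<nu> - d\<^sup>2/dx\<^sup>2\<close> factors as \<open>(\<mu> - d/dx) (\<mu> + d/dx)\<close> with \<open>\<mu> = sqrt \<nu>\<close>, so two first order periodic
problems solve it.\<close>

lemma second_order_periodic:
  fixes h :: "real \<Rightarrow> real"
  assumes per: "\<And>x. h (x + 1) = h x" and cont: "continuous_on UNIV h" and lam: "\<nu> > 0"
  obtains Z Z' where "\<And>x. Z (x + 1) = Z x" "\<And>x. (Z has_real_derivative Z' x) (at x)"
    "\<And>x. (Z' has_real_derivative \<nu> * Z x - h x) (at x)"
proof -
  define \<mu> where "\<mu> = sqrt \<nu>"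
  have mu: "\<mu> \<noteq> 0" "\<mu> * \<mu> = \<nu>" using lam by (auto simp: \<mu>_def)
  obtain Y where Y: "\<And>x. (Y has_real_derivative h x - \<mu> * Y x) (at x)" "\<And>x. Y (x + 1) = Y x"
    using first_order_periodic[of h \<mu>] per cont mu by metis
  have "continuous_on UNIV (\<lambda>x. - Y x)"
    using continuous_on_deriv[OF Y(1)] by (intro continuous_intros)
  moreover have "- Y (x + 1) = - Y x" "- \<mu> \<noteq> 0" for x using Y(2) mu by auto
  ultimately obtain Z where Z: "\<And>x. (Z has_real_derivative - Y x - (- \<mu>) * Z x) (at x)" "\<And>x. Z (x + 1) = Z x"
    using first_order_periodic[of "\<lambda>x. - Y x" "- \<mu>"] by metis
  have "((\<lambda>x. - Y x - (- \<mu>) * Z x) has_real_derivative \<nu> * Z x - h x) (at x)" for x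
    by (auto intro!: derivative_eq_intros Y Z simp: mu(2)[symmetric] algebra_simps)
  then show ?thesis by (rule that[OF Z(2) Z(1)])
qed

text \<open>At a maximum of \<open>Z\<close> the second derivative is nonpositive, so \<open>\<nu> Z \<le> h\<close> there; a minimum gives the opposite
bound. Hence the resolvent has norm at most \<open>1/\<nu>\<close> for the supremum norm.\<close>

lemma second_order_periodic_bound:
  fixes h Z Z' :: "real \<Rightarrow> real"
  assumes lam: "\<nu> > 0" and per: "\<And>x. Z (x + 1) = Z x"
    and Z: "\<And>x. (Z has_real_derivative Z' x) (at x)"
    and Z': "\<And>x. (Z' has_real_derivative \<nu> * Z x - h x) (at x)"
    and b: "\<And>x. \<bar>h x\<bar> \<le> b"
  shows "\<bar>Z x\<bar> \<le> b / \<nu>"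
proof -
  obtain u where u: "\<And>x. Z x \<le> Z u"
    using periodic_attains_max[of Z] per continuous_on_deriv[OF Z] by metis
  obtain l where l: "\<And>x. Z l \<le> Z x"
    using periodic_attains_min[of Z] per continuous_on_deriv[OF Z] by metis
  have "\<nu> * Z u \<le> b" using second_derivative_at_max(2)[OF Z Z' u] b[of u] by simp
  moreover have "\<nu> * Z l \<ge> - b" using second_derivative_at_min(2)[OF Z Z' l] b[of l] by simp
  moreover have "\<nu> * Z x \<le> \<nu> * Z u" "\<nu> * Z l \<le> \<nu> * Z x" using u l lam by auto
  ultimately have "\<bar>\<nu> * Z x\<bar> \<le> b" by linarith
  then show ?thesis using lam by (simp add: abs_mult field_simps)
qed

section \<open>A nonlinear periodic problem\<close>

lemma closed_periodic_bcontfun: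
  "closed {Z :: real \<Rightarrow>\<^sub>C real. \<forall>x. apply_bcontfun Z (x + 1) = apply_bcontfun Z x}"
proof -
  have ev: "continuous_on UNIV (\<lambda>Z :: real \<Rightarrow>\<^sub>C real. apply_bcontfun Z x)" for x
    unfolding continuous_on_iff using dist_bounded le_less_trans by blast
  show ?thesis by (intro closed_Collect_all closed_Collect_eq ev)
qed

text \<open>Rewrite \<open>W'' = n(W) - B\<close> as \<open>\<nu> W - W'' = m(W) + B\<close> with \<open>m(t) = \<nu> t - n(t)\<close>. Since the slopes of \<open>n\<close> lie between \<open>\<delta>\<close>
and \<open>\<nu>\<close>, the function \<open>m\<close> has Lipschitz constant \<open>\<nu> - \<delta>\<close>, and the resolvent contributes a factor \<open>1/\<nu>\<close>: the fixed
point map is a contraction of the space of continuous periodic functions.\<close>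

lemma monotone_periodic_problem:
  fixes n B :: "real \<Rightarrow> real"
  assumes del: "0 < \<delta>"
    and n: "\<And>s t. s \<le> t \<Longrightarrow> \<delta> * (t - s) \<le> n t - n s" "\<And>s t. s \<le> t \<Longrightarrow> n t - n s \<le> \<nu> * (t - s)"
    and per: "\<And>x. B (x + 1) = B x" and cont: "continuous_on UNIV B"
  obtains W V where "\<And>x. W (x + 1) = W x" "\<And>x. (W has_real_derivative V x) (at x)"
    "\<And>x. (V has_real_derivative n (W x) - B x) (at x)"
proof -
  have dl: "\<delta> \<le> \<nu>" using n[of 0 1] by simp
  then have lam: "\<nu> > 0" using del by simp
  define S where "S = {Z :: real \<Rightarrow>\<^sub>C real. \<forall>x. apply_bcontfun Z (x + 1) = apply_bcontfun Z x}"
  define m where "m t = \<nu> * t - n t" for t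
  have m: "\<bar>m s - m t\<bar> \<le> (\<nu> - \<delta>) * \<bar>s - t\<bar>" for s t
    using n[of s t] n[of t s] by (cases "s \<le> t") (auto simp: m_def abs_if algebra_simps)
  have mc: "continuous_on UNIV m"
    by (rule lipschitz_on_continuous_on[of "\<nu> - \<delta>"], rule lipschitz_onI)
      (use m dl in \<open>auto simp: dist_real_def\<close>)
  have hper: "m (Z (x + 1)) + B (x + 1) = m (Z x) + B x" if "Z \<in> S" for Z x
    using that per by (simp add: S_def)
  have hcont: "continuous_on UNIV (\<lambda>x. m (apply_bcontfun Z x) + B x)" for Z
    by (intro continuous_intros cont continuous_on_compose2[OF mc]) auto
  have "\<exists>Y Y'. (\<forall>x. Y (x + 1) = Y x) \<and> (\<forall>x. (Y has_real_derivative Y' x) (at x)) \<and>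
      (\<forall>x. (Y' has_real_derivative \<nu> * Y x - (m (Z x) + B x)) (at x))" if "Z \<in> S" for Z
    using second_order_periodic[of "\<lambda>x. m (Z x) + B x", OF hper[OF that] hcont lam] by metis
  then obtain Y Y' where Y: "\<And>Z x. Z \<in> S \<Longrightarrow> Y Z (x + 1) = Y Z x"
      "\<And>Z x. Z \<in> S \<Longrightarrow> (Y Z has_real_derivative Y' Z x) (at x)"
      "\<And>Z x. Z \<in> S \<Longrightarrow> (Y' Z has_real_derivative \<nu> * Y Z x - (m (Z x) + B x)) (at x)"
    by metis
  define T where "T Z = Bcontfun (Y Z)" for Z
  have T: "apply_bcontfun (T Z) = Y Z" if Z: "Z \<in> S" for Z
  proof -
    have c: "continuous_on UNIV (Y Z)" using continuous_on_deriv[OF Y(2)[OF Z]] .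
    obtain b where "\<And>x. \<bar>Y Z x\<bar> \<le> b"
      using periodic_bounded[of "Y Z"] Y(1)[OF Z] c by metis
    then have "Y Z \<in> bcontfun" using c by (intro bcontfun_normI) auto
    then show ?thesis by (simp add: T_def Bcontfun_inverse)
  qed
  have "\<exists>!Z\<in>S. T Z = Z"
  proof (rule Banach_fix)
    show "complete S" unfolding S_def by (simp add: complete_eq_closed closed_periodic_bcontfun)
    have "0 \<in> S" by (simp add: S_def)
    then show "S \<noteq> {}" by blast
    show "0 \<le> (\<nu> - \<delta>) / \<nu>" "(\<nu> - \<delta>) / \<nu> < 1" using dl lam del by simp_all
    show "T ` S \<subseteq> S"
    proof safe
      fix Z assume Z: "Z \<in> S"
      show "T Z \<in> S" using T[OF Z] Y(1)[OF Z] by (simp add: S_def)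
    qed
    fix Z1 Z2 assume Z: "Z1 \<in> S" "Z2 \<in> S"
    show "dist (T Z1) (T Z2) \<le> (\<nu> - \<delta>) / \<nu> * dist Z1 Z2"
    proof (rule dist_bound)
      fix x
      have "\<bar>Y Z1 x - Y Z2 x\<bar> \<le> ((\<nu> - \<delta>) * dist Z1 Z2) / \<nu>"
      proof (rule second_order_periodic_bound[OF lam, where Z = "\<lambda>x. Y Z1 x - Y Z2 x"
            and Z' = "\<lambda>x. Y' Z1 x - Y' Z2 x" and h = "\<lambda>x. m (Z1 x) - m (Z2 x)"])
        fix x
        show "Y Z1 (x + 1) - Y Z2 (x + 1) = Y Z1 x - Y Z2 x" using Y(1) Z by simp
        show "((\<lambda>x. Y Z1 x - Y Z2 x) has_real_derivative Y' Z1 x - Y' Z2 x) (at x)"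
          by (intro derivative_intros Y Z)
        show "((\<lambda>x. Y' Z1 x - Y' Z2 x) has_real_derivative
            \<nu> * (Y Z1 x - Y Z2 x) - (m (Z1 x) - m (Z2 x))) (at x)"
          using DERIV_diff[OF Y(3)[OF Z(1)] Y(3)[OF Z(2)], of x] by (simp add: algebra_simps)
        have "\<bar>Z1 x - Z2 x\<bar> \<le> dist Z1 Z2"
          using dist_bounded[of Z1 x Z2] by (simp add: dist_real_def)
        then have "(\<nu> - \<delta>) * \<bar>Z1 x - Z2 x\<bar> \<le> (\<nu> - \<delta>) * dist Z1 Z2"
          using dl by (intro mult_left_mono) auto
        with m[of "Z1 x" "Z2 x"] show "\<bar>m (Z1 x) - m (Z2 x)\<bar> \<le> (\<nu> - \<delta>) * dist Z1 Z2"
          by linarith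
      qed
      then show "dist (apply_bcontfun (T Z1) x) (apply_bcontfun (T Z2) x) \<le> (\<nu> - \<delta>) / \<nu> * dist Z1 Z2"
        using T Z by (simp add: dist_real_def)
    qed
  qed
  then obtain Z where Z: "Z \<in> S" "T Z = Z" by blast
  have eq: "apply_bcontfun Z = Y Z" using T[OF Z(1)] Z(2) by simp
  show ?thesis
  proof (rule that[of "Y Z" "Y' Z"])
    fix x
    show "Y Z (x + 1) = Y Z x" using Y(1)[OF Z(1)] .
    show "(Y Z has_real_derivative Y' Z x) (at x)" using Y(2)[OF Z(1)] .
    show "(Y' Z has_real_derivative n (Y Z x) - B x) (at x)"
      using Y(3)[OF Z(1), of x] by (simp add: m_def eq)
  qed
qed

text \<open>Outside \<open>[m, M]\<close> the nonlinearity \<open>\<kappa> (1 - 1/t)\<close> is replaced by a linear function, which makes its slopes bounded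
above and bounded away from zero on the whole line.\<close>

lemma truncated_inverse:
  fixes \<kappa> m M :: real
  assumes "\<kappa> > 0" "0 < m" "m \<le> M"
  defines "n \<equiv> \<lambda>t. \<kappa> * (1 - 1 / max m (min M t)) + \<kappa> / M\<^sup>2 * (t - max m (min M t))"
  shows "s \<le> t \<Longrightarrow> \<kappa> / M\<^sup>2 * (t - s) \<le> n t - n s"
    and "s \<le> t \<Longrightarrow> n t - n s \<le> \<kappa> / m\<^sup>2 * (t - s)"
proof -
  assume st: "s \<le> t"
  define c where "c t = max m (min M t)" for t
  have c: "c s \<le> c t" "c t - c s \<le> t - s" using st by (auto simp: c_def)
  have cb: "m \<le> c r" "c r \<le> M" "c r > 0" for r using assms by (auto simp: c_def)
  have "\<kappa> * (1 - 1 / c t) - \<kappa> * (1 - 1 / c s) = \<kappa> / (c s * c t) * (c t - c s)"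
    using cb(3)[of s] cb(3)[of t] by (simp add: field_simps)
  then have e: "n t - n s = \<kappa> / (c s * c t) * (c t - c s) + \<kappa> / M\<^sup>2 * ((t - s) - (c t - c s))"
    unfolding n_def c_def[symmetric] by (simp add: algebra_simps add_divide_distrib diff_divide_distrib)
  have "c s * c t \<le> M\<^sup>2" unfolding power2_eq_square
    using cb assms by (intro mult_mono) (auto intro: less_imp_le)
  then have 1: "\<kappa> / M\<^sup>2 \<le> \<kappa> / (c s * c t)"
    using assms cb(3)[of s] cb(3)[of t] by (intro divide_left_mono) auto
  have "m\<^sup>2 \<le> c s * c t" unfolding power2_eq_square
    using cb assms by (intro mult_mono) (auto intro: less_imp_le)
  then have 2: "\<kappa> / (c s * c t) \<le> \<kappa> / m\<^sup>2"
    using assms cb(3)[of s] cb(3)[of t] by (intro divide_left_mono) auto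
  show "\<kappa> / M\<^sup>2 * (t - s) \<le> n t - n s"
  proof -
    have "\<kappa> / M\<^sup>2 * (t - s) = \<kappa> / M\<^sup>2 * (c t - c s) + \<kappa> / M\<^sup>2 * ((t - s) - (c t - c s))"
      by (simp only: right_diff_distrib)
    then show ?thesis using mult_right_mono[OF 1, of "c t - c s"] c(1) unfolding e by simp
  qed
  have "n t - n s \<le> \<kappa> / m\<^sup>2 * (c t - c s) + \<kappa> / m\<^sup>2 * ((t - s) - (c t - c s))"
    unfolding e using 1 2 c by (intro add_mono mult_right_mono) auto
  then show "n t - n s \<le> \<kappa> / m\<^sup>2 * (t - s)" by (simp only: right_diff_distrib)
qed

text \<open>The truncated problem has a solution whose values lie where nothing was truncated. At a minimum of
\<open>W\<close> the equation gives \<open>\<kappa> (1 - 1/W) \<ge> B\<close>, hence a positive lower bound. For the upper bound subtract the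
inhomogeneity: if \<open>p'' = B\<close>, then \<open>W + p\<close> has second derivative \<open>\<kappa> (1 - 1/W)\<close>, so that \<open>W \<le> 1\<close> where \<open>W + p\<close> is
maximal, and elsewhere \<open>W\<close> exceeds 1 by at most the oscillation of \<open>p\<close>. Integrating the equation over a
period yields the normalisation of \<open>1/W\<close>.\<close>

lemma singular_periodic_problem:
  fixes B :: "real \<Rightarrow> real"
  assumes \<kappa>: "\<kappa> > 0"
    and per: "\<And>x. B (x + 1) = B x" and cont: "continuous_on UNIV B" and mean: "integral {0..1} B = 0"
  obtains W V where "\<And>x. W x > 0" "\<And>x. W (x + 1) = W x" "\<And>x. (W has_real_derivative V x) (at x)"
    "\<And>x. (V has_real_derivative \<kappa> * (1 - 1 / W x) - B x) (at x)" "integral {0..1} (\<lambda>x. 1 / W x) = 1"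
proof -
  obtain q where q: "\<And>x. (q has_real_derivative B x) (at x)" "\<And>x. q (x + 1) = q x" "integral {0..1} q = 0"
    using periodic_primitive[of B] per cont mean by metis
  obtain p where p: "\<And>x. (p has_real_derivative q x) (at x)" "\<And>x. p (x + 1) = p x"
    using periodic_primitive[of q] q(2,3) continuous_on_deriv[OF q(1)] by metis
  obtain b where b: "b > 0" "\<And>x. \<bar>B x\<bar> \<le> b" using periodic_bounded[of B] per cont by metis
  obtain a where a: "a > 0" "\<And>x. \<bar>p x\<bar> \<le> a"
    using periodic_bounded[of p] p(2) continuous_on_deriv[OF p(1)] by metis
  define m where "m = \<kappa> / (\<kappa> + b)"
  define M where "M = 1 + 2 * a"
  have mM: "0 < m" "m \<le> 1" "1 \<le> M" using \<kappa> a(1) b(1) by (auto simp: m_def M_def field_simps)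
  have m: "\<kappa> * (1 - 1 / m) = - b" using \<kappa> b(1) by (simp add: m_def field_simps)
  define n where "n = (\<lambda>t. \<kappa> * (1 - 1 / max m (min M t)) + \<kappa> / M\<^sup>2 * (t - max m (min M t)))"
  have M2: "\<kappa> / M\<^sup>2 > 0" using \<kappa> mM by simp
  have n: "\<And>s t. s \<le> t \<Longrightarrow> \<kappa> / M\<^sup>2 * (t - s) \<le> n t - n s" "\<And>s t. s \<le> t \<Longrightarrow> n t - n s \<le> \<kappa> / m\<^sup>2 * (t - s)"
    using truncated_inverse[OF \<kappa> mM(1), of M] mM unfolding n_def by auto
  obtain W V where W: "\<And>x. W (x + 1) = W x" "\<And>x. (W has_real_derivative V x) (at x)"
    "\<And>x. (V has_real_derivative n (W x) - B x) (at x)"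
    using monotone_periodic_problem[of "\<kappa> / M\<^sup>2" n "\<kappa> / m\<^sup>2" B, OF M2 n per cont] by metis
  have mono: "s \<le> t" if "n s \<le> n t" for s t
  proof (rule ccontr)
    assume "\<not> s \<le> t"
    then have "\<kappa> / M\<^sup>2 * (s - t) > 0" using M2 by (intro mult_pos_pos) auto
    moreover have "\<kappa> / M\<^sup>2 * (s - t) \<le> n s - n t" using n(1)[of t s] \<open>\<not> s \<le> t\<close> by simp
    ultimately show False using that by linarith
  qed
  have lower: "m \<le> W x" for x
  proof -
    obtain l where l: "\<And>x. W l \<le> W x"
      using periodic_attains_min[of W] W(1) continuous_on_deriv[OF W(2)] by metis
    have "n m \<le> n (W l)"
      using second_derivative_at_min(2)[OF W(2,3) l] b(2)[of l] m mM by (simp add: n_def)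
    then show ?thesis using mono l[of x] by (meson order_trans)
  qed
  have upper: "W x \<le> M" for x
  proof -
    have Z: "((\<lambda>x. W x + p x) has_real_derivative V x + q x) (at x)" for x
      by (intro derivative_intros W p)
    have Z': "((\<lambda>x. V x + q x) has_real_derivative n (W x)) (at x)" for x
      using DERIV_add[OF W(3) q(1), of x] by simp
    obtain u where u: "\<And>x. W x + p x \<le> W u + p u"
      using periodic_attains_max[of "\<lambda>x. W x + p x"] W(1) p(2) continuous_on_deriv[OF Z] by metis
    have "n (W u) \<le> n 1"
      using second_derivative_at_max(2)[OF Z Z' u] mM by (simp add: n_def)
    then have "W u \<le> 1" by (rule mono)
    then show ?thesis using u[of x] a(2)[of x] a(2)[of u] by (simp add: M_def)
  qed
  have nW: "n (W x) = \<kappa> * (1 - 1 / W x)" for x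
    using lower[of x] upper[of x] by (simp add: n_def)
  have pos: "W x > 0" for x using lower[of x] mM by linarith
  have cW: "continuous_on {0..1} (\<lambda>x. 1 / W x)"
    using pos by (intro continuous_intros continuous_on_deriv[OF W(2)]) (auto simp: less_imp_neq[symmetric])
  have V01: "V 1 = V 0"
  proof -
    have "((\<lambda>x. W (x + 1)) has_real_derivative V 1) (at 0)"
      using W(2)[of 1] DERIV_shift[of W "V 1" 0 1] by simp
    then show ?thesis using W(2)[of 0] by (simp add: W(1) DERIV_unique)
  qed
  have "integral {0..1} (\<lambda>x. \<kappa> * (1 - 1 / W x) - B x) = 0"
    using integral_of_derivative[of V _ 0 1, OF W(3)] V01 by (auto simp: nW has_integral_iff)
  moreover have "integral {0..1} (\<lambda>x. \<kappa> * (1 - 1 / W x) - B x)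
      = \<kappa> * (1 - integral {0..1} (\<lambda>x. 1 / W x))"
    using mean cW continuous_on_subset[OF cont, of "{0..1}"]
    by (simp add: integral_diff integrable_continuous_real continuous_intros)
  ultimately have "integral {0..1} (\<lambda>x. 1 / W x) = 1" using \<kappa> by simp
  then show ?thesis using that[of W V] pos W nW by simp
qed

text \<open>For \<open>\<kappa> = 0\<close> the solutions are \<open>C + q\<close> with \<open>q\<close> a fixed double primitive, here normalised to have minimum zero,
and the normalisation of \<open>1/W\<close> determines \<open>C > 0\<close>. The integral of \<open>1/(C + q)\<close> is at most 1 for \<open>C = 1\<close>; it is large
for small \<open>C\<close> because \<open>q\<close> vanishes to second order at its minimum, so that \<open>1/q\<close> is not integrable there.\<close>

lemma linear_periodic_problem:
  fixes B :: "real \<Rightarrow> real"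
  assumes per: "\<And>x. B (x + 1) = B x" and cont: "continuous_on UNIV B" and mean: "integral {0..1} B = 0"
  obtains W V where "\<And>x. W x > 0" "\<And>x. W (x + 1) = W x" "\<And>x. (W has_real_derivative V x) (at x)"
    "\<And>x. (V has_real_derivative - B x) (at x)" "integral {0..1} (\<lambda>x. 1 / W x) = 1"
proof -
  have mean': "integral {0..1} (\<lambda>x. - B x) = 0" and cont': "continuous_on UNIV (\<lambda>x. - B x)"
    using mean cont by (auto intro: continuous_intros)
  obtain V where V: "\<And>x. (V has_real_derivative - B x) (at x)" "\<And>x. V (x + 1) = V x" "integral {0..1} V = 0"
    using periodic_primitive[of "\<lambda>x. - B x"] per cont' mean' by metis
  obtain p where p: "\<And>x. (p has_real_derivative V x) (at x)" "\<And>x. p (x + 1) = p x"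
    using periodic_primitive[of V] V(2,3) continuous_on_deriv[OF V(1)] by metis
  obtain b where b: "b > 0" "\<And>x. \<bar>B x\<bar> \<le> b" using periodic_bounded[of B] per cont by metis
  obtain x0 where x0: "x0 \<in> {0..1}" "\<And>x. p x0 \<le> p x"
    using periodic_attains_min[of p] p(2) continuous_on_deriv[OF p(1)] by metis
  define q where "q x = p x - p x0" for x
  have q: "(q has_real_derivative V x) (at x)" "q (x + 1) = q x" "q x \<ge> 0" for x
    using p x0 by (auto simp: q_def[abs_def] intro!: derivative_eq_intros)
  have cq: "continuous_on A q" for A using continuous_on_deriv[OF q(1)] .
  have mvt: "\<exists>z. \<bar>z - s\<bar> \<le> \<bar>t - s\<bar> \<and> f t - f s = (t - s) * f' z"
    if f: "\<And>x. (f has_real_derivative f' x) (at x)" for f f' :: "real \<Rightarrow> real" and s t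
  proof (cases s t rule: linorder_cases)
    case less
    then show ?thesis using MVT2[OF less, of f f'] f by force
  next
    case greater
    then obtain z where "t < z" "z < s" "f s - f t = (s - t) * f' z" using MVT2[OF greater, of f f'] f by auto
    then show ?thesis by (intro exI[of _ z]) (auto simp: algebra_simps)
  qed auto
  have V0: "V x0 = 0" using second_derivative_at_min(1)[OF p(1) V(1) x0(2)] .
  have quad: "q x \<le> b * (x - x0)\<^sup>2" for x
  proof -
    obtain z where z: "\<bar>z - x0\<bar> \<le> \<bar>x - x0\<bar>" "q x - q x0 = (x - x0) * V z"
      using mvt[OF q(1)] by blast
    obtain y where y: "V z - V x0 = (z - x0) * (- B y)" using mvt[OF V(1)] by blast
    have "\<bar>V z\<bar> \<le> \<bar>x - x0\<bar> * b"
      using y V0 b(2)[of y] z(1) by (auto simp: abs_mult intro!: mult_mono)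
    then have "\<bar>(x - x0) * V z\<bar> \<le> \<bar>x - x0\<bar> * (\<bar>x - x0\<bar> * b)"
      unfolding abs_mult by (intro mult_left_mono) auto
    then show ?thesis using z(2) by (simp add: q_def power2_eq_square algebra_simps abs_mult_self_eq)
  qed
  define J where "J C = integral {0..1} (\<lambda>x. 1 / (C + q x))" for C
  \<comment> \<open>For \<open>C = \<delta>\<^sup>2\<close> the integrand is at least \<open>1 / ((1 + b) \<delta>\<^sup>2)\<close> at distance at most \<open>\<delta>\<close> from the minimum. An interval
of length \<open>\<delta>\<close> therefore contributes at least \<open>1 / ((1 + b) \<delta>)\<close>, which is 2 for this choice.\<close>
  define \<delta> where "\<delta> = 1 / (2 * (1 + b))"
  have del: "0 < \<delta>" "\<delta> \<le> 1 / 2" using b(1) by (auto simp: \<delta>_def field_simps)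
  have int: "(\<lambda>x. 1 / (C + q x)) integrable_on {l..r}" if "C > 0" for C l r
    using that q(3) by (intro integrable_continuous_real continuous_intros cq) (metis add_pos_nonneg less_irrefl)
  have J1: "J 1 \<le> 1"
  proof -
    have "J 1 \<le> integral {0..1} (\<lambda>x::real. 1)"
      unfolding J_def using q(3) by (intro integral_le int) (auto simp: add_pos_nonneg divide_le_eq_1)
    then show ?thesis by simp
  qed
  have J2: "1 \<le> J (\<delta>\<^sup>2)"
  proof -
    \<comment> \<open>The interval of length \<open>\<delta>\<close> next to the minimum must stay inside the period \<open>[0, 1]\<close>.\<close>
    define l where "l = (if x0 \<le> 1 / 2 then x0 else x0 - \<delta>)"
    have l: "{l..l + \<delta>} \<subseteq> {0..1}" "\<And>x. x \<in> {l..l + \<delta>} \<Longrightarrow> \<bar>x - x0\<bar> \<le> \<delta>"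
      using del x0(1) by (auto simp: l_def split: if_splits)
    have "(1 + b) * \<delta> = 1 / 2" using b(1) by (simp add: \<delta>_def field_simps)
    then have "(1 + b) * \<delta>\<^sup>2 = \<delta> / 2" by (simp add: power2_eq_square mult.assoc[symmetric])
    then have "2 = integral {l..l + \<delta>} (\<lambda>x::real. 1 / ((1 + b) * \<delta>\<^sup>2))"
      using del by (simp only:) simp
    also have "\<dots> \<le> integral {l..l + \<delta>} (\<lambda>x. 1 / (\<delta>\<^sup>2 + q x))"
    proof (rule integral_le)
      fix x assume "x \<in> {l..l + \<delta>}"
      then have "(x - x0)\<^sup>2 \<le> \<delta>\<^sup>2" using l(2) by (intro abs_le_square_iff[THEN iffD1]) (use del in auto)
      then have "q x \<le> b * \<delta>\<^sup>2" using quad[of x] b(1) by (meson mult_left_mono order_trans less_imp_le)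
      then show "1 / ((1 + b) * \<delta>\<^sup>2) \<le> 1 / (\<delta>\<^sup>2 + q x)"
        using del q(3)[of x] b(1) by (intro divide_left_mono) (auto simp: algebra_simps intro!: mult_pos_pos add_pos_nonneg)
    qed (use del in \<open>auto intro!: int\<close>)
    also have "\<dots> \<le> J (\<delta>\<^sup>2)"
      unfolding J_def using l del q(3) by (intro integral_subset_le int) (auto intro!: add_nonneg_nonneg)
    finally show ?thesis by simp
  qed
  have "\<exists>C\<ge>\<delta>\<^sup>2. C \<le> 1 \<and> J C = 1"
  proof (rule IVT2')
    show "\<delta>\<^sup>2 \<le> 1" using del by (simp add: power_le_one)
    have "continuous_on ({\<delta>\<^sup>2..1} \<times> cbox 0 1) (\<lambda>z. 1 / (fst z + q (snd z)))"
    proof (intro continuous_intros continuous_on_compose2[OF cq[of UNIV]] ballI)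
      fix z assume "z \<in> {\<delta>\<^sup>2..1} \<times> cbox (0::real) 1"
      then have "fst z \<ge> \<delta>\<^sup>2" by auto
      moreover have "\<delta>\<^sup>2 > 0" using del by simp
      ultimately show "fst z + q (snd z) \<noteq> 0" using q(3)[of "snd z"] by linarith
    qed auto
    then show "continuous_on {\<delta>\<^sup>2..1} J"
      using integral_continuous_on_param[of "{\<delta>\<^sup>2..1}" 0 1 "\<lambda>C x. 1 / (C + q x)"]
      by (simp add: J_def[abs_def] case_prod_unfold)
  qed (use J1 J2 in auto)
  then obtain C where C: "C \<ge> \<delta>\<^sup>2" "J C = 1" by blast
  have "C > 0" using C(1) del by (meson zero_less_power less_le_trans)
  then show ?thesis
    using q V C(2) by (intro that[of "\<lambda>x. C + q x" V])
      (auto simp: J_def intro!: add_pos_nonneg derivative_eq_intros)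
qed

lemma periodic_profile_exists:
  fixes B :: "real \<Rightarrow> real"
  assumes "\<kappa> \<ge> 0" "\<And>x. B (x + 1) = B x" "continuous_on UNIV B" "integral {0..1} B = 0"
  obtains W V where "\<And>x. W x > 0" "\<And>x. W (x + 1) = W x" "\<And>x. (W has_real_derivative V x) (at x)"
    "\<And>x. (V has_real_derivative \<kappa> * (1 - 1 / W x) - B x) (at x)" "integral {0..1} (\<lambda>x. 1 / W x) = 1"
proof (cases "\<kappa> = 0")
  case True
  then show ?thesis using linear_periodic_problem[of B] assms(2-4) that by (metis diff_0 mult_zero_left)
next
  case False
  then show ?thesis using singular_periodic_problem[of \<kappa> B] assms that by (metis less_eq_real_def)
qed

section \<open>From symplectic to complex coordinates\<close>

text \<open>With \<open>x\<close> the symplectic and \<open>y\<close> the complex coordinate, \<open>y = U x\<close> where \<open>U' = 1/W\<close>, and \<open>X\<close> is the inverse of \<open>U\<close>. The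
normalisation of \<open>1/W\<close> says that \<open>U\<close> advances by 1 over a period, so \<open>X y - y\<close> is periodic. The additive constant of
\<open>U\<close> is still free, and it is the one thing that can make the mean of \<open>X y - y\<close> vanish, as required for a periodic
primitive \<open>\<psi>\<close>.\<close>

lemma inverse_profile:
  fixes W :: "real \<Rightarrow> real"
  assumes W: "\<And>x. W x > 0" "\<And>x. W (x + 1) = W x" "smooth_on UNIV W"
    and int: "integral {0..1} (\<lambda>x. 1 / W x) = 1"
  obtains X U \<psi> where
    "\<And>x. (U has_real_derivative 1 / W x) (at x)" "\<And>x. X (U x) = x" "\<And>y. U (X y) = y"
    "\<And>y. (X has_real_derivative W (X y)) (at y)" "\<And>y. X (y + 1) = X y + 1"
    "\<And>y. (\<psi> has_real_derivative X y - y) (at y)" "\<And>y. \<psi> (y + 1) = \<psi> y"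
    "smooth_on UNIV X" "smooth_on UNIV \<psi>"
proof -
  have cont: "continuous_on UNIV (\<lambda>x. 1 / W x)"
    using smooth_on_frechet(3)[OF W(3)] W(1) by (intro continuous_intros) (auto simp: less_imp_neq[symmetric])
  obtain U\<^sub>0 where U: "\<And>x. (U\<^sub>0 has_real_derivative 1 / W x) (at x)"
    using exists_primitive[OF cont] by blast
  have shift: "U\<^sub>0 (x + 1) = U\<^sub>0 x + 1" for x
  proof -
    have "((\<lambda>x. U\<^sub>0 (x + 1)) has_real_derivative 1 / W x) (at x)" for x
      using U[of "x + 1"] W(2) by (simp add: DERIV_shift)
    then have "((\<lambda>x. U\<^sub>0 (x + 1) - U\<^sub>0 x) has_real_derivative 0) (at x)" for x
      using DERIV_diff[OF _ U, of "\<lambda>x. U\<^sub>0 (x + 1)"] by fastforce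
    then have "U\<^sub>0 (x + 1) - U\<^sub>0 x = U\<^sub>0 (0 + 1) - U\<^sub>0 0"
      using DERIV_isconst_all[of "\<lambda>x. U\<^sub>0 (x + 1) - U\<^sub>0 x" x 0] by simp
    also have "\<dots> = 1" using integral_of_derivative[OF U, of 0 1] int by (simp add: has_integral_iff)
    finally show ?thesis by simp
  qed
  have shift_int: "U\<^sub>0 (of_int n) = U\<^sub>0 0 + of_int n" for n
    using periodic_of_int[of "\<lambda>x. U\<^sub>0 x - x" 0 n] shift by simp
  have mono: "U\<^sub>0 x < U\<^sub>0 y" if "x < y" for x y
  proof (rule DERIV_pos_imp_increasing[OF that])
    show "\<exists>d. (U\<^sub>0 has_real_derivative d) (at z) \<and> d > 0" for z
      using U W(1)[of z] by (intro exI[of _ "1 / W z"]) simp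
  qed
  have inj: "inj U\<^sub>0"
    by (rule linorder_injI) (use mono in \<open>auto dest: less_imp_neq\<close>)
  have surj: "\<exists>x. U\<^sub>0 x = y" for y
  proof -
    define n where "n = \<lfloor>y - U\<^sub>0 0\<rfloor>"
    have n: "U\<^sub>0 (of_int n) \<le> y" "y \<le> U\<^sub>0 (of_int (n + 1))"
      unfolding shift_int n_def by linarith+
    then show ?thesis
      using IVT'[of U\<^sub>0 "of_int n" y "of_int (n + 1)"] continuous_on_deriv[OF U] by auto
  qed
  define X\<^sub>0 where "X\<^sub>0 = inv U\<^sub>0"
  have UX: "U\<^sub>0 (X\<^sub>0 y) = y" for y using surj[of y] by (auto simp: X\<^sub>0_def intro!: f_inv_into_f)
  have XU: "X\<^sub>0 (U\<^sub>0 x) = x" for x using inj by (simp add: X\<^sub>0_def)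
  have X: "(X\<^sub>0 has_real_derivative W (X\<^sub>0 y)) (at y)" for y
  proof -
    have c: "isCont X\<^sub>0 (U\<^sub>0 (X\<^sub>0 y))"
      by (rule isCont_inverse_function[where d = 1]) (use XU DERIV_isCont[OF U] in auto)
    have "(X\<^sub>0 has_real_derivative inverse (1 / W (X\<^sub>0 y))) (at y)"
      by (rule DERIV_inverse_function[where a = "y - 1" and b = "y + 1" and f = U\<^sub>0])
        (use U UX c W(1)[of "X\<^sub>0 y"] in auto)
    then show ?thesis by simp
  qed
  have Xs: "X\<^sub>0 (y + 1) = X\<^sub>0 y + 1" for y
    using shift[of "X\<^sub>0 y"] XU[of "X\<^sub>0 y + 1"] by (simp add: UX)
  obtain G where G: "\<And>y. (G has_real_derivative X\<^sub>0 y) (at y)"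
    using exists_primitive[OF continuous_on_deriv[OF X]] by blast
  \<comment> \<open>Translating \<open>X\<^sub>0\<close> by \<open>k\<close> changes the mean of \<open>X\<^sub>0 y - y\<close> by \<open>- k\<close>; its value for \<open>k = 0\<close> is \<open>G 1 - G 0 - 1 / 2\<close>.\<close>
  define k where "k = G 1 - G 0 - 1 / 2"
  have Gs: "G (y + 1) - G y = G 1 - G 0 + y" for y
  proof -
    have "((\<lambda>y. G (y + 1)) has_real_derivative X\<^sub>0 y + 1) (at y)" for y
      using G[of "y + 1"] Xs by (simp add: DERIV_shift)
    then have "((\<lambda>y. G (y + 1) - G y - y) has_real_derivative (X\<^sub>0 y + 1) - X\<^sub>0 y - 1) (at y)" for y
      by (intro derivative_intros G)
    then show ?thesis
      using DERIV_isconst_all[of "\<lambda>y. G (y + 1) - G y - y" y 0] by simp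
  qed
  define X where "X y = X\<^sub>0 (y - k)" for y
  define \<psi> where "\<psi> y = G (y - k) - y\<^sup>2 / 2" for y
  have X': "(X has_real_derivative W (X y)) (at y)" for y
    unfolding X_def[abs_def] using X[of "y - k"] DERIV_shift[of X\<^sub>0 _ y "- k"] by simp
  have G': "((\<lambda>y. G (y - k)) has_real_derivative X y) (at y)" for y
    unfolding X_def using G[of "y - k"] DERIV_shift[of G _ y "- k"] by simp
  have \<psi>': "(\<psi> has_real_derivative X y - y) (at y)" for y
    unfolding \<psi>_def[abs_def] by (auto intro!: derivative_eq_intros G')
  have sX: "smooth_on UNIV X" by (rule smooth_on_ODE[OF W(3) X'])
  have "smooth_on UNIV (\<lambda>y::real. - y)" by (intro smooth_on_bounded_linear bounded_linear_minus bounded_linear_ident) auto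
  then have "smooth_on UNIV (\<lambda>y. X y + - y)" by (intro smooth_on_add sX) auto
  then have s\<psi>: "smooth_on UNIV \<psi>" using smooth_on_primitive[of "\<lambda>y. X y - y" \<psi>] \<psi>' by simp
  have \<psi>s: "\<psi> (y + 1) = \<psi> y" for y
    using Gs[of "y - k"] by (simp add: \<psi>_def k_def power2_eq_square algebra_simps)
  show ?thesis
  proof (rule that[of "\<lambda>x. U\<^sub>0 x + k" X \<psi>])
    show "((\<lambda>x. U\<^sub>0 x + k) has_real_derivative 1 / W x) (at x)" for x
      by (auto intro!: derivative_eq_intros U)
  qed (use X' \<psi>' sX s\<psi> \<psi>s XU UX Xs[of "_ - k"] in \<open>auto simp: X_def algebra_simps\<close>)
qed

section \<open>Functions of one linear coordinate\<close>

lemma dir_deriv_eqI: "(f has_derivative D) (at x) \<Longrightarrow> dir_deriv f x v = D v"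
  by (metis dir_deriv_def frechet_derivative_at)

lemma has_derivative_linear_coordinate:
  fixes g :: "real \<Rightarrow> real"
  assumes "bounded_linear l" "(g has_real_derivative d) (at (l x))"
  shows "((\<lambda>x. g (l x)) has_derivative (\<lambda>h. d * l h)) (at x)"
  using has_derivative_compose[OF bounded_linear_imp_has_derivative[OF assms(1)], of g "(*) d"] assms(2)
  by (simp add: has_field_derivative_def)

lemma smooth_on_linear_coordinate:
  fixes g :: "real \<Rightarrow> real" and l :: "'a::real_normed_vector \<Rightarrow> real"
  assumes "bounded_linear l" "smooth_on UNIV g"
  shows "smooth_on UNIV (\<lambda>x. g (l x))"
  by (rule smooth_on_compose[OF open_UNIV smooth_on_bounded_linear[OF assms(1) open_UNIV] assms(2)]) simp

lemma bounded_linear_Re_nth: "bounded_linear (\<lambda>z::complex^'n. Re (z $ i))"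
  by (rule bounded_linear_compose[OF bounded_linear_Re bounded_linear_vec_nth])

lemma dir_deriv_Re_coordinate:
  fixes g :: "real \<Rightarrow> real"
  assumes "(g has_real_derivative d) (at (Re (z $ i)))"
  shows "dir_deriv (\<lambda>z. complex_of_real (g (Re (z $ i))) * c) z v = of_real (d * Re (v $ i)) * c"
proof -
  have "((\<lambda>z. complex_of_real (g (Re (z $ i))) * c) has_derivative
      (\<lambda>h. of_real (d * Re (h $ i)) * c)) (at z)"
    by (intro has_derivative_mult_left has_derivative_of_real
        has_derivative_linear_coordinate[OF bounded_linear_Re_nth assms])
  then show ?thesis by (rule dir_deriv_eqI)
qed

lemma hess_first_coordinate:
  assumes "\<And>t. (g has_real_derivative g' t) (at t)" "\<And>t. (g' has_real_derivative g'' t) (at t)"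
  shows "hess (\<lambda>y. g (y $ 1)) y $ i $ j = (if i = 1 \<and> j = 1 then g'' (y $ 1) else 0)"
proof -
  have 1: "dir_deriv (\<lambda>y::real^2. g (y $ 1)) y (axis j 1) = (if j = 1 then g' (y $ 1) else 0)" for y
    by (subst dir_deriv_eqI[OF has_derivative_linear_coordinate[OF bounded_linear_vec_nth assms(1)]])
      (simp add: axis_def)
  have 2: "dir_deriv (\<lambda>y::real^2. g' (y $ 1)) y (axis i 1) = (if i = 1 then g'' (y $ 1) else 0)"
    by (subst dir_deriv_eqI[OF has_derivative_linear_coordinate[OF bounded_linear_vec_nth assms(2)]])
      (simp add: axis_def)
  have 0: "dir_deriv (\<lambda>y::real^2. 0::real) y (axis i 1) = 0"
    by (rule dir_deriv_eqI) (rule has_derivative_const)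
  have "hess (\<lambda>y. g (y $ 1)) y $ i $ j = dir_deriv (\<lambda>y. if j = 1 then g' (y $ 1) else 0) y (axis i 1)"
    by (simp add: hess_def 1)
  then show ?thesis by (cases "j = 1") (simp_all add: 0 2)
qed

lemma matrix_inv_2:
  fixes A :: "'a::field^2^2"
  assumes "det A \<noteq> 0"
  shows "matrix_inv A $ 1 $ 1 = A $ 2 $ 2 / det A" "matrix_inv A $ 1 $ 2 = - A $ 1 $ 2 / det A"
    "matrix_inv A $ 2 $ 1 = - A $ 2 $ 1 / det A" "matrix_inv A $ 2 $ 2 = A $ 1 $ 1 / det A"
proof -
  define k where "k = inverse (det A)"
  have k: "(A $ 1 $ 1 * A $ 2 $ 2 - A $ 1 $ 2 * A $ 2 $ 1) * k = 1"
    using assms by (simp add: k_def det_2[symmetric])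
  define B :: "'a^2^2" where "B = vector [vector [A $ 2 $ 2 * k, - A $ 1 $ 2 * k],
    vector [- A $ 2 $ 1 * k, A $ 1 $ 1 * k]]"
  have AB: "A ** B = mat 1" "B ** A = mat 1"
    using k by (auto simp: vec_eq_iff forall_2 matrix_matrix_mult_def mat_def sum_2 B_def algebra_simps)
  have "A ** matrix_inv A = mat 1 \<and> matrix_inv A ** A = mat 1"
    unfolding matrix_inv_def using someI[of "\<lambda>A'. A ** A' = mat 1 \<and> A' ** A = mat 1" B] AB by blast
  then have "matrix_inv A = B"
    by (metis AB(1) matrix_mul_assoc matrix_mul_lid matrix_mul_rid)
  then show "matrix_inv A $ 1 $ 1 = A $ 2 $ 2 / det A" "matrix_inv A $ 1 $ 2 = - A $ 1 $ 2 / det A"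
    "matrix_inv A $ 2 $ 1 = - A $ 2 $ 1 / det A" "matrix_inv A $ 2 $ 2 = A $ 1 $ 1 / det A"
    by (simp_all add: B_def k_def divide_inverse)
qed

section \<open>Separated invariant potentials\<close>

text \<open>The metric data in one coordinate: \<open>X = v\<^sub>1'\<close> for \<open>v\<^sub>1(t) = t\<^sup>2/2 + \<psi>(t)\<close>, with inverse \<open>U\<close>, and \<open>W\<close> is \<open>v\<^sub>1''\<close> expressed in the
symplectic coordinate, so that \<open>v\<^sub>1'' = W \<circ> X\<close>. The functions \<open>V\<close> and \<open>R\<close> are \<open>W'\<close> and \<open>W''\<close>.\<close>

locale separated_potential =
  fixes W V R X U \<psi> :: "real \<Rightarrow> real"
  assumes W_pos: "W x > 0" and W_periodic: "W (x + 1) = W x"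
    and W_deriv: "(W has_real_derivative V x) (at x)"
    and V_deriv: "(V has_real_derivative R x) (at x)"
    and U_deriv: "(U has_real_derivative 1 / W x) (at x)"
    and X_U: "X (U x) = x" and U_X: "U (X y) = y"
    and X_deriv: "(X has_real_derivative W (X y)) (at y)"
    and X_shift: "X (y + 1) = X y + 1"
    and \<psi>_deriv: "(\<psi> has_real_derivative X y - y) (at y)"
    and \<psi>_periodic: "\<psi> (y + 1) = \<psi> y"
    and smooth_W: "smooth_on UNIV W" and smooth_X: "smooth_on UNIV X" and smooth_\<psi>: "smooth_on UNIV \<psi>"
begin

definition v :: "real^2 \<Rightarrow> real" where
  "v y = (norm y)\<^sup>2 / 2 + \<psi> (y $ 1)"

lemma v_eq: "v y = ((y $ 1)\<^sup>2 / 2 + \<psi> (y $ 1)) + (y $ 2)\<^sup>2 / 2"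
proof -
  have "(norm y)\<^sup>2 = (y $ 1)\<^sup>2 + (y $ 2)\<^sup>2"
    unfolding power2_norm_eq_inner by (simp add: inner_vec_def sum_2 power2_eq_square)
  then show ?thesis by (simp add: v_def)
qed

lemma v_has_derivative: "(v has_derivative (\<lambda>h. X (y $ 1) * h $ 1 + y $ 2 * h $ 2)) (at y)"
proof -
  have "((\<lambda>t. t\<^sup>2 / 2 + \<psi> t) has_real_derivative X t) (at t)" for t
    by (auto intro!: derivative_eq_intros \<psi>_deriv)
  moreover have "((\<lambda>t::real. t\<^sup>2 / 2) has_real_derivative t) (at t)" for t
    by (auto intro!: derivative_eq_intros)
  ultimately show ?thesis unfolding v_eq[abs_def]
    by (intro has_derivative_add; intro has_derivative_linear_coordinate[OF bounded_linear_vec_nth])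
qed

lemma grad_v: "grad v y $ 1 = X (y $ 1)" "grad v y $ 2 = y $ 2"
  by (simp_all add: grad_def dir_deriv_eqI[OF v_has_derivative] axis_def)

lemma hess_v: "hess v y $ 1 $ 1 = W (X (y $ 1))" "hess v y $ 1 $ 2 = 0"
  "hess v y $ 2 $ 1 = 0" "hess v y $ 2 $ 2 = 1"
proof -
  have 1: "dir_deriv (\<lambda>y::real^2. X (y $ 1)) y h = W (X (y $ 1)) * h $ 1" for h
    by (rule dir_deriv_eqI[OF has_derivative_linear_coordinate[OF bounded_linear_vec_nth X_deriv]])
  have 2: "dir_deriv (\<lambda>y::real^2. y $ 2) y h = h $ 2" for h
    by (rule dir_deriv_eqI) (rule bounded_linear_imp_has_derivative[OF bounded_linear_vec_nth])
  have "dir_deriv v y (axis 1 1) = X (y $ 1)" "dir_deriv v y (axis 2 1) = y $ 2" for y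
    by (simp_all add: dir_deriv_eqI[OF v_has_derivative] axis_def)
  then show "hess v y $ 1 $ 1 = W (X (y $ 1))" "hess v y $ 1 $ 2 = 0"
    "hess v y $ 2 $ 1 = 0" "hess v y $ 2 $ 2 = 1"
    by (simp_all add: hess_def 1 2 axis_def)
qed

lemma det_hess_v: "det (hess v y) = W (X (y $ 1))"
  by (simp add: det_2 hess_v)

text \<open>Since \<open>d/dy = w d/dx\<close> for \<open>x = X y\<close> and \<open>w = W \<circ> X\<close>, the expression \<open>(1/w) (log w)''\<close> in the complex coordinate is
\<open>W''\<close> in the symplectic one. This turns a fourth order equation for \<open>\<psi>\<close> into a second order one.\<close>

lemma scalar_curvature_v: "scalar_curvature v y = - R (X (y $ 1)) / 4"
proof -
  have d1: "((\<lambda>t. ln (W (X t))) has_real_derivative V (X t)) (at t)" for t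
    using W_pos[of "X t"] by (auto intro!: derivative_eq_intros DERIV_chain2[OF W_deriv X_deriv])
  have d2: "((\<lambda>t. V (X t)) has_real_derivative R (X t) * W (X t)) (at t)" for t
    by (rule DERIV_chain2[OF V_deriv X_deriv])
  have H: "hess (\<lambda>y. ln (det (hess v y))) y $ i $ j
      = (if i = 1 \<and> j = 1 then R (X (y $ 1)) * W (X (y $ 1)) else 0)" for i j
    using hess_first_coordinate[OF d1 d2] by (simp add: det_hess_v)
  have "matrix_inv (hess v y) $ 1 $ 1 = 1 / W (X (y $ 1))"
    using matrix_inv_2(1)[of "hess v y"] W_pos[of "X (y $ 1)"] by (simp add: det_hess_v hess_v)
  then show ?thesis
    using W_pos[of "X (y $ 1)"] by (simp add: scalar_curvature_def sum_2 H)
qed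

lemma legendre_v: "legendre v x = x $ 1 * U (x $ 1) - ((U (x $ 1))\<^sup>2 / 2 + \<psi> (U (x $ 1))) + (x $ 2)\<^sup>2 / 2"
proof -
  have "(THE y. grad v y = x) = vector [U (x $ 1), x $ 2]"
  proof (rule the_equality)
    show "grad v (vector [U (x $ 1), x $ 2]) = x"
      by (simp add: vec_eq_iff forall_2 grad_v X_U)
    fix y assume "grad v y = x"
    then have "x $ 1 = X (y $ 1)" "x $ 2 = y $ 2" using grad_v[of y] by auto
    then show "y = vector [U (x $ 1), x $ 2]"
      by (simp add: vec_eq_iff forall_2 U_X)
  qed
  then show ?thesis
    by (simp add: legendre_def v_eq inner_vec_def sum_2 power2_eq_square)
qed

lemma grad_legendre_v: "grad (legendre v) x $ 1 = U (x $ 1)"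
proof -
  have "((\<lambda>t. t * U t - ((U t)\<^sup>2 / 2 + \<psi> (U t))) has_real_derivative U t) (at t)" for t
    using W_pos[of t]
    by (auto intro!: derivative_eq_intros U_deriv DERIV_chain2[OF \<psi>_deriv U_deriv] simp: X_U field_simps)
  moreover have "((\<lambda>t::real. t\<^sup>2 / 2) has_real_derivative t) (at t)" for t
    by (auto intro!: derivative_eq_intros)
  ultimately have "(legendre v has_derivative (\<lambda>h. U (x $ 1) * h $ 1 + x $ 2 * h $ 2)) (at x)"
    unfolding legendre_v[abs_def]
    by (intro has_derivative_add; intro has_derivative_linear_coordinate[OF bounded_linear_vec_nth])
  then show ?thesis by (simp add: grad_def dir_deriv_eqI axis_def)
qed

lemma \<psi>_of_int: "\<psi> (y + of_int n) = \<psi> y"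
  by (rule periodic_of_int) (rule \<psi>_periodic)

lemma X_of_int: "X (y + of_int n) = X y + of_int n"
  using periodic_of_int[of "\<lambda>y. X y - y" y n] X_shift by simp

lemma convex_v: "convex_on UNIV v"
proof -
  have c1: "convex_on UNIV (\<lambda>t. t\<^sup>2 / 2 + \<psi> t)"
  proof (rule f''_ge0_imp_convex)
    show "((\<lambda>t. t\<^sup>2 / 2 + \<psi> t) has_real_derivative X t) (at t)" for t
      by (auto intro!: derivative_eq_intros \<psi>_deriv)
    show "(X has_real_derivative W (X t)) (at t)" for t by (rule X_deriv)
  qed (use W_pos less_imp_le in auto)
  have c2: "convex_on UNIV (\<lambda>t::real. t\<^sup>2 / 2)"
    by (rule f''_ge0_imp_convex[where f' = "\<lambda>t. t" and f'' = "\<lambda>_. 1"])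
      (auto intro!: derivative_eq_intros)
  have "convex_on UNIV (\<lambda>y::real^2. g (y $ i))" if "convex_on UNIV g" for g :: "real \<Rightarrow> real" and i
    using that by (auto simp: convex_on_def)
  from convex_on_add[OF this[OF c1, of 1] this[OF c2, of 2]]
  show ?thesis by (simp add: v_eq[abs_def])
qed

lemma invariant_potential_v: "invariant_potential v"
  unfolding invariant_potential_def
proof (intro conjI exI[of _ "\<lambda>y. \<psi> (y $ 1)"] allI impI convex_v)
  show "smooth_on UNIV (\<lambda>y::real^2. \<psi> (y $ 1))"
    by (rule smooth_on_linear_coordinate[OF bounded_linear_vec_nth smooth_\<psi>])
  fix y m :: "real^2" assume "\<forall>i. m $ i \<in> \<int>"
  then obtain n where "m $ 1 = of_int n" by (metis Ints_cases)
  then show "\<psi> ((y + m) $ 1) = \<psi> (y $ 1)" by (simp add: \<psi>_of_int)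
qed (simp add: v_def)

definition w :: "complex^2 \<Rightarrow> real" where
  "w z = W (X (Re (z $ 1)))"

lemma w_pos: "w z > 0" by (simp add: w_def W_pos)

lemma pot_matrix_v: "pot_matrix v z $ 1 $ 1 = of_real (w z)" "pot_matrix v z $ 1 $ 2 = 0"
  "pot_matrix v z $ 2 $ 1 = 0" "pot_matrix v z $ 2 $ 2 = 1"
  by (simp_all add: pot_matrix_def cmat_def hess_v re_vec_def w_def)

lemma det_pot_matrix_v: "det (pot_matrix v z) = of_real (w z)"
  by (simp add: det_2 pot_matrix_v)

lemma form11_pot_matrix_v:
  "form11 (pot_matrix v) z a b = \<i> * (of_real (w z) * dz_dzbar 1 1 a b + dz_dzbar 2 2 a b)"
  by (simp add: form11_def sum_2 pot_matrix_v)

lemma w_deriv: "((\<lambda>t. W (X t)) has_real_derivative V (X t) * W (X t)) (at t)"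
  by (rule DERIV_chain2[OF W_deriv X_deriv])

lemma lattice_shift:
  assumes "l \<in> lattice"
  obtains n where "Re ((z + l) $ 1) = Re (z $ 1) + of_int n"
proof -
  from assms obtain n where "Re (l $ 1) = of_int n" unfolding lattice_def by (auto elim: Ints_cases)
  then show ?thesis using that by simp
qed

lemma w_lattice: "l \<in> lattice \<Longrightarrow> w (z + l) = w z"
  using lattice_shift[of l z] periodic_of_int[of W, OF W_periodic] by (metis X_of_int w_def)

lemma pot_matrix_lattice: "l \<in> lattice \<Longrightarrow> pot_matrix v (z + l) = pot_matrix v z"
  by (simp add: vec_eq_iff forall_2 pot_matrix_v w_lattice)

lemma smooth_pot_matrix: "smooth_on UNIV (\<lambda>z. pot_matrix v z $ i $ j)"
proof -
  have "smooth_on UNIV (\<lambda>t. W (X t))"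
    by (rule smooth_on_compose[OF _ smooth_X smooth_W]) auto
  from smooth_on_of_real[OF smooth_on_linear_coordinate[OF bounded_linear_Re_nth this]]
  have 1: "smooth_on UNIV (\<lambda>z. complex_of_real (w z))" by (simp add: w_def)
  have c: "smooth_on UNIV (\<lambda>z::complex^2. complex_of_real c)" for c
    by (intro smooth_on_of_real smooth_on_const) auto
  consider "i = 1" "j = 1" | "i = 1" "j = 2" | "i = 2" "j = 1" | "i = 2" "j = 2"
    using exhaust_2 by metis
  then show ?thesis
    using 1 c[of 0] c[of 1] by cases (simp_all add: pot_matrix_v)
qed

lemma hermitian_pos_def_pot_matrix: "hermitian_pos_def (pot_matrix v z)"
proof -
  have "Re (\<Sum>i\<in>UNIV. \<Sum>j\<in>UNIV. pot_matrix v z $ i $ j * a $ i * cnj (a $ j)) > 0" if "a \<noteq> 0" for a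
  proof -
    have "Re (\<Sum>i\<in>UNIV. \<Sum>j\<in>UNIV. pot_matrix v z $ i $ j * a $ i * cnj (a $ j))
        = w z * (cmod (a $ 1))\<^sup>2 + (cmod (a $ 2))\<^sup>2"
      unfolding cmod_power2 by (simp add: sum_2 pot_matrix_v power2_eq_square algebra_simps)
    moreover have "a $ 1 \<noteq> 0 \<or> a $ 2 \<noteq> 0" using that by (auto simp: vec_eq_iff forall_2)
    ultimately show ?thesis using w_pos[of z] by (auto intro: add_pos_nonneg add_nonneg_pos)
  qed
  then show ?thesis by (simp add: hermitian_pos_def_def forall_2 pot_matrix_v)
qed

lemma closed_form2_v: "closed_form2 (form11 (pot_matrix v))"
proof -
  have D: "dir_deriv (\<lambda>z. form11 (pot_matrix v) z a b) z c
      = of_real (V (X (Re (z $ 1))) * W (X (Re (z $ 1))) * Re (c $ 1)) * (\<i> * dz_dzbar 1 1 a b)" for a b c z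
  proof -
    have "((\<lambda>z. complex_of_real (W (X (Re (z $ 1)))) * (\<i> * dz_dzbar 1 1 a b) + \<i> * dz_dzbar 2 2 a b)
        has_derivative (\<lambda>h. of_real (V (X (Re (z $ 1))) * W (X (Re (z $ 1))) * Re (h $ 1)) * (\<i> * dz_dzbar 1 1 a b) + 0)) (at z)"
      by (intro has_derivative_add has_derivative_const has_derivative_mult_left has_derivative_of_real
        has_derivative_linear_coordinate[OF bounded_linear_Re_nth] w_deriv)
    moreover have "(\<lambda>z. form11 (pot_matrix v) z a b) =
       (\<lambda>z. complex_of_real (W (X (Re (z $ 1)))) * (\<i> * dz_dzbar 1 1 a b) + \<i> * dz_dzbar 2 2 a b)"
      by (simp add: fun_eq_iff form11_pot_matrix_v w_def algebra_simps)
    ultimately show ?thesis by (simp add: dir_deriv_eqI)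
  qed
  \<comment> \<open>The cyclic sum is the 3-form \<open>k d(Re z\<^sub>1) \<and> dz\<^sub>1 \<and> d(cnj z\<^sub>1)\<close>, up to a factor, and involves a single complex
coordinate.\<close>
  have "of_real (k * Re (a $ 1)) * (\<i> * dz_dzbar 1 1 b c) - of_real (k * Re (b $ 1)) * (\<i> * dz_dzbar 1 1 a c)
      + of_real (k * Re (c $ 1)) * (\<i> * dz_dzbar 1 1 a b) = 0" for k and a b c :: "complex^2"
    by (simp add: dz_dzbar_def complex_eq_iff algebra_simps)
  then show ?thesis by (simp only: closed_form2_def D) blast
qed

lemma kahler_form_v: "kahler_form (form11 (pot_matrix v))"
  unfolding kahler_form_def
  using closed_form2_v smooth_pot_matrix pot_matrix_lattice hermitian_pos_def_pot_matrix by blast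

lemma U1_invariant_v: "U1_invariant (form11 (pot_matrix v))"
proof -
  have "re_vec (z + (\<chi> i. \<i> * complex_of_real (t $ i))) = re_vec z" for z and t :: "real^2"
    by (simp add: re_vec_def vec_eq_iff)
  then show ?thesis by (auto simp: U1_invariant_def form11_def pot_matrix_def fun_eq_iff)
qed

text \<open>The primitive is \<open>2 \<psi>'(Re z\<^sub>1) d(Im z\<^sub>1)\<close>, which descends to the torus since \<open>\<psi>' = X y - y\<close> is periodic.\<close>

lemma cohomologous_v: "cohomologous (form11 (pot_matrix v)) flat_form"
proof -
  define g where "g t = 2 * (X t - t)" for t
  define \<eta> :: form1 where "\<eta> z a = of_real (g (Re (z $ 1))) * of_real (Im (a $ 1))" for z a
  have g: "(g has_real_derivative 2 * (W (X t) - 1)) (at t)" for t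
    unfolding g_def by (auto intro!: derivative_eq_intros X_deriv)
  have "torus_form1 \<eta>"
    unfolding torus_form1_def
  proof (intro conjI allI ballI)
    show "linear (\<eta> z)" for z
      by (rule linearI) (auto simp: \<eta>_def algebra_simps complex_eq_iff)
    have "smooth_on UNIV g"
    proof -
      have "smooth_on UNIV (\<lambda>t::real. - t)"
        by (intro smooth_on_bounded_linear bounded_linear_minus bounded_linear_ident) auto
      then have "smooth_on UNIV (\<lambda>t. 2 * (X t + - t))"
        by (rule smooth_on_mult[OF open_UNIV smooth_on_const[OF open_UNIV] smooth_on_add[OF open_UNIV smooth_X]])
      then show ?thesis by (simp add: g_def[abs_def])
    qed
    then show "smooth_on UNIV (\<lambda>z. \<eta> z a)" for a
      unfolding \<eta>_def of_real_mult[symmetric]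
      by (rule smooth_on_of_real[OF smooth_on_mult[OF open_UNIV
          smooth_on_linear_coordinate[OF bounded_linear_Re_nth] smooth_on_const[OF open_UNIV]] open_UNIV])
    fix z l :: "complex^2" assume "l \<in> lattice"
    then obtain n where "Re ((z + l) $ 1) = Re (z $ 1) + of_int n" using lattice_shift by blast
    then show "\<eta> (z + l) = \<eta> z" by (simp add: \<eta>_def fun_eq_iff g_def X_of_int)
  qed
  moreover have "form11 (pot_matrix v) z a b - flat_form z a b = ext_deriv1 \<eta> z a b" for z a b
  proof -
    have D: "dir_deriv (\<lambda>z. \<eta> z c) z d
        = of_real (2 * (W (X (Re (z $ 1))) - 1) * Re (d $ 1)) * of_real (Im (c $ 1))" for c d
      unfolding \<eta>_def by (rule dir_deriv_Re_coordinate) (rule g)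
    have F: "flat_form z a b = \<i> * (dz_dzbar 1 1 a b + dz_dzbar 2 2 a b)"
      by (simp add: flat_form_def form11_def sum_2 mat_def)
    show ?thesis
      unfolding ext_deriv1_def D F form11_pot_matrix_v
      by (simp add: w_def dz_dzbar_def complex_eq_iff algebra_simps)
  qed
  ultimately show ?thesis unfolding cohomologous_def by blast
qed

end

section \<open>Second derivatives\<close>

definition second_deriv :: "('a::real_normed_vector \<Rightarrow> real) \<Rightarrow> 'a \<Rightarrow> 'a \<Rightarrow> 'a \<Rightarrow> real" where
  "second_deriv g z u v = frechet_derivative (\<lambda>x. frechet_derivative g (at x) v) (at z) u"

text \<open>Applying the mean value theorem first along \<open>u\<close>, then along \<open>v\<close>, expresses the symmetric second difference by
\<open>D\<^sub>v D\<^sub>u g\<close> at a nearby point; exchanging \<open>u\<close> and \<open>v\<close> expresses it by \<open>D\<^sub>u D\<^sub>v g\<close>.\<close>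

lemma second_difference_mean_value:
  fixes g :: "'a::real_normed_vector \<Rightarrow> real"
  assumes g: "smooth_on S g" and S: "ball z r \<subseteq> S"
    and h: "h > 0" "h * (norm u + norm v) < r"
  shows "\<exists>p. dist z p < r \<and> dist z p \<le> h * (norm u + norm v) \<and>
    g (z + h *\<^sub>R u + h *\<^sub>R v) - g (z + h *\<^sub>R u) - g (z + h *\<^sub>R v) + g z = h * h * second_deriv g p v u"
proof -
  let ?D = "\<lambda>x. frechet_derivative g (at x)"
  have near: "dist z (z + s *\<^sub>R u + t *\<^sub>R v) \<le> h * (norm u + norm v)"
    if "0 \<le> s" "s \<le> h" "0 \<le> t" "t \<le> h" for s t
  proof -
    have "norm (s *\<^sub>R u + t *\<^sub>R v) \<le> s * norm u + t * norm v"
      using norm_triangle_ineq[of "s *\<^sub>R u" "t *\<^sub>R v"] that by simp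
    also have "\<dots> \<le> h * norm u + h * norm v"
      using that by (intro add_mono mult_right_mono) auto
    finally show ?thesis by (simp add: dist_norm norm_minus_commute algebra_simps)
  qed
  have inS: "z + s *\<^sub>R u + t *\<^sub>R v \<in> S" if "0 \<le> s" "s \<le> h" "0 \<le> t" "t \<le> h" for s t
    using near[OF that] h(2) S by auto
  have deriv: "((\<lambda>s. f (p + s *\<^sub>R w)) has_real_derivative frechet_derivative f (at (p + s *\<^sub>R w)) w) (at s)"
    if f: "smooth_on S f" and "p + s *\<^sub>R w \<in> S" for f :: "'a \<Rightarrow> real" and p w s
  proof -
    have fd: "(f has_derivative frechet_derivative f (at (p + s *\<^sub>R w))) (at (p + s *\<^sub>R w))"
      using smooth_on_frechet(2)[OF that] .
    have "((\<lambda>s. p + s *\<^sub>R w) has_derivative (\<lambda>t. t *\<^sub>R w)) (at s)"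
      by (auto intro!: derivative_eq_intros)
    from has_derivative_compose[OF this fd]
    have "((\<lambda>s. f (p + s *\<^sub>R w)) has_derivative (\<lambda>t. frechet_derivative f (at (p + s *\<^sub>R w)) (t *\<^sub>R w))) (at s)" .
    then show ?thesis
      using linear_scale[OF has_derivative_linear[OF fd]]
      by (simp add: has_field_derivative_def mult.commute[of _ "frechet_derivative f (at (p + s *\<^sub>R w)) w"])
  qed
  have "\<exists>\<xi>>0. \<xi> < h \<and> (g (z + h *\<^sub>R u + h *\<^sub>R v) - g (z + h *\<^sub>R u)) - (g (z + 0 *\<^sub>R u + h *\<^sub>R v) - g (z + 0 *\<^sub>R u))
      = (h - 0) * (?D (z + \<xi> *\<^sub>R u + h *\<^sub>R v) u - ?D (z + \<xi> *\<^sub>R u) u)"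
  proof (rule MVT2[OF h(1)])
    fix s assume s: "0 \<le> s" "s \<le> h"
    have "((\<lambda>s. g (z + h *\<^sub>R v + s *\<^sub>R u)) has_real_derivative ?D (z + h *\<^sub>R v + s *\<^sub>R u) u) (at s)"
      using inS[OF s, of h] h(1) by (intro deriv[OF g]) (simp add: add_ac)
    moreover have "((\<lambda>s. g (z + s *\<^sub>R u)) has_real_derivative ?D (z + s *\<^sub>R u) u) (at s)"
      using inS[OF s, of 0] h(1) by (intro deriv[OF g]) simp
    ultimately show "((\<lambda>s. g (z + s *\<^sub>R u + h *\<^sub>R v) - g (z + s *\<^sub>R u)) has_real_derivative
        ?D (z + s *\<^sub>R u + h *\<^sub>R v) u - ?D (z + s *\<^sub>R u) u) (at s)"
      using DERIV_diff by (simp add: add_ac)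
  qed
  then obtain \<xi> where xi: "0 < \<xi>" "\<xi> < h" and 1: "g (z + h *\<^sub>R u + h *\<^sub>R v) - g (z + h *\<^sub>R u) - g (z + h *\<^sub>R v) + g z
      = h * (?D (z + \<xi> *\<^sub>R u + h *\<^sub>R v) u - ?D (z + \<xi> *\<^sub>R u + 0 *\<^sub>R v) u)"
    by auto
  have "\<exists>\<eta>>0. \<eta> < h \<and> ?D (z + \<xi> *\<^sub>R u + h *\<^sub>R v) u - ?D (z + \<xi> *\<^sub>R u + 0 *\<^sub>R v) u
      = (h - 0) * second_deriv g (z + \<xi> *\<^sub>R u + \<eta> *\<^sub>R v) v u"
    unfolding second_deriv_def
    by (rule MVT2[OF h(1)]) (use xi inS in \<open>auto intro!: deriv[OF smooth_on_frechet(1)[OF g]]\<close>)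
  then obtain \<eta> where eta: "0 < \<eta>" "\<eta> < h" and 2: "?D (z + \<xi> *\<^sub>R u + h *\<^sub>R v) u - ?D (z + \<xi> *\<^sub>R u + 0 *\<^sub>R v) u
      = h * second_deriv g (z + \<xi> *\<^sub>R u + \<eta> *\<^sub>R v) v u" by auto
  show ?thesis
    using near[of \<xi> \<eta>] xi eta h(2) 1 unfolding 2
    by (intro exI[of _ "z + \<xi> *\<^sub>R u + \<eta> *\<^sub>R v"]) auto
qed

lemma second_deriv_symmetric:
  fixes g :: "'a::real_normed_vector \<Rightarrow> real"
  assumes g: "smooth_on S g" and S: "open S" "z \<in> S"
  shows "second_deriv g z u v = second_deriv g z v u"
proof (rule ccontr)
  assume ne: "second_deriv g z u v \<noteq> second_deriv g z v u"
  define e where "e = \<bar>second_deriv g z u v - second_deriv g z v u\<bar> / 2"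
  have e: "e > 0" using ne by (simp add: e_def)
  have cont: "\<exists>d>0. \<forall>p. dist z p < d \<longrightarrow> \<bar>second_deriv g p a b - second_deriv g z a b\<bar> < e" for a b
  proof -
    have "continuous_on S (\<lambda>p. second_deriv g p a b)"
      unfolding second_deriv_def
      by (rule smooth_on_frechet(3)[OF smooth_on_frechet(1)[OF smooth_on_frechet(1)[OF g]]])
    then have "isCont (\<lambda>p. second_deriv g p a b) z"
      using S by (simp add: continuous_on_eq_continuous_at)
    then show ?thesis
      using e unfolding continuous_at_eps_delta dist_real_def by (simp add: dist_commute)
  qed
  obtain d1 where d1: "d1 > 0" "\<And>p. dist z p < d1 \<Longrightarrow> \<bar>second_deriv g p u v - second_deriv g z u v\<bar> < e"
    using cont[of u v] by blast
  obtain d2 where d2: "d2 > 0" "\<And>p. dist z p < d2 \<Longrightarrow> \<bar>second_deriv g p v u - second_deriv g z v u\<bar> < e"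
    using cont[of v u] by blast
  obtain d3 where d3: "d3 > 0" "ball z d3 \<subseteq> S" using S by (auto simp: open_contains_ball)
  define r where "r = min d1 (min d2 d3)"
  have r: "r > 0" "ball z r \<subseteq> S" "r \<le> d1" "r \<le> d2" using d1 d2 d3 by (auto simp: r_def)
  define h where "h = r / (norm u + norm v + 1)"
  have n: "norm u + norm v + 1 > 0" by (simp add: add_nonneg_pos)
  have h: "h > 0" "h * (norm u + norm v) < r" "h * (norm v + norm u) < r"
    using r(1) n by (simp_all add: h_def pos_divide_less_eq algebra_simps)
  obtain p where p: "dist z p < r"
    "g (z + h *\<^sub>R u + h *\<^sub>R v) - g (z + h *\<^sub>R u) - g (z + h *\<^sub>R v) + g z = h * h * second_deriv g p v u"
    using second_difference_mean_value[OF g r(2) h(1,2)] by blast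
  obtain q where q: "dist z q < r"
    "g (z + h *\<^sub>R v + h *\<^sub>R u) - g (z + h *\<^sub>R v) - g (z + h *\<^sub>R u) + g z = h * h * second_deriv g q u v"
    using second_difference_mean_value[OF g r(2) h(1,3)] by blast
  have swap: "z + h *\<^sub>R v + h *\<^sub>R u = z + h *\<^sub>R u + h *\<^sub>R v" by simp
  have "h * h * second_deriv g p v u = h * h * second_deriv g q u v"
    using p(2) q(2)[unfolded swap] by linarith
  then have "second_deriv g p v u = second_deriv g q u v" using h(1) by simp
  then show False using d1(2)[of q] d2(2)[of p] p(1) q(1) r(3,4) unfolding e_def by (simp add: field_simps abs_if split: if_splits)
qed

lemma second_deriv_add:
  fixes f g k :: "'a::real_normed_vector \<Rightarrow> real"
  assumes f: "smooth_on S f" and g: "smooth_on S g" and S: "open S" "z \<in> S"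
    and k: "\<And>x. x \<in> S \<Longrightarrow> f x + g x = k x"
  shows "second_deriv k z u v = second_deriv f z u v + second_deriv g z u v"
proof -
  let ?D = "\<lambda>f x. frechet_derivative f (at x) v"
  have 1: "?D f x + ?D g x = ?D k x" if x: "x \<in> S" for x
  proof -
    have "((\<lambda>x. f x + g x) has_derivative
        (\<lambda>v. frechet_derivative f (at x) v + frechet_derivative g (at x) v)) (at x)"
      by (intro has_derivative_add smooth_on_frechet(2)[OF _ x] f g)
    from has_derivative_transform_within_open[OF this S(1) x k]
    show ?thesis using dir_deriv_eqI[of k _ x v] by (simp add: dir_deriv_def)
  qed
  have "((\<lambda>x. ?D f x + ?D g x) has_derivative (\<lambda>u. second_deriv f z u v + second_deriv g z u v)) (at z)"
    unfolding second_deriv_def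
    by (intro has_derivative_add smooth_on_frechet(2)[OF smooth_on_frechet(1) S(2)] f g)
  from has_derivative_transform_within_open[OF this S 1]
  show ?thesis
    using dir_deriv_eqI[of "?D k" _ z u] unfolding second_deriv_def[of k] dir_deriv_def by simp
qed

lemma second_deriv_linear_coordinate:
  fixes g :: "real \<Rightarrow> real"
  assumes "bounded_linear l"
    and "\<And>t. (g has_real_derivative g' t) (at t)" "\<And>t. (g' has_real_derivative g'' t) (at t)"
  shows "second_deriv (\<lambda>x. g (l x)) z u v = g'' (l z) * l u * l v"
proof -
  have "frechet_derivative (\<lambda>x. g (l x)) (at x) v = g' (l x) * l v" for x
    using dir_deriv_eqI[OF has_derivative_linear_coordinate[OF assms(1,2)], of x v]
    by (simp add: dir_deriv_def)
  moreover have "((\<lambda>x. g' (l x) * l v) has_derivative (\<lambda>h. (g'' (l z) * l h) * l v)) (at z)"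
    by (intro has_derivative_mult_left has_derivative_linear_coordinate assms)
  ultimately show ?thesis
    using dir_deriv_eqI[of "\<lambda>x. g' (l x) * l v" _ z u] by (simp add: second_deriv_def dir_deriv_def)
qed

lemma smooth_on_ln: "smooth_on {0<..} (ln :: real \<Rightarrow> real)"
proof (rule fun_algebra_smooth[where G = "{ln, inverse}"])
  fix g :: "real \<Rightarrow> real" assume g: "g \<in> {ln, inverse}"
  let ?A = "fun_algebra {ln, inverse :: real \<Rightarrow> real}"
  have i: "inverse \<in> ?A" by (rule fun_algebra.gen) simp
  have 1: "(\<lambda>x. inverse x * v) \<in> ?A" for v by (intro fun_algebra.mult[OF i] fun_algebra.const)
  have 2: "(\<lambda>x. inverse x * inverse x * (- v)) \<in> ?A" for v
    by (rule fun_algebra.mult[OF fun_algebra.mult[OF i i] fun_algebra.const])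
  have d1: "(ln has_derivative (\<lambda>v. inverse x * v)) (at x)" if "x > 0" for x :: real
    using that by (auto intro!: derivative_eq_intros simp: divide_inverse)
  have d2: "(inverse has_derivative (\<lambda>v. inverse x * inverse x * (- v))) (at x)" if "x > 0" for x :: real
    using that by (auto intro!: derivative_eq_intros)
  from g show "\<exists>D. (\<forall>x\<in>{0<..}. (g has_derivative D x) (at x)) \<and> (\<forall>v. (\<lambda>x. D x v) \<in> ?A)"
  proof
    assume "g = ln"
    then show ?thesis using d1 1 by (intro exI[of _ "\<lambda>x v. inverse x * v"]) simp
  next
    assume "g \<in> {inverse}"
    then show ?thesis using d2 2 by (intro exI[of _ "\<lambda>x v. inverse x * inverse x * (- v)"]) simp
  qed
qed (auto intro: fun_algebra.gen)

section \<open>Curvature\<close>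

text \<open>The complex Hessian in terms of real second derivatives; its real part is symmetric and its imaginary part
antisymmetric in the two indices as soon as these commute.\<close>

lemma wirt_wirt_bar_of_real:
  fixes g :: "complex^2 \<Rightarrow> real"
  assumes g: "smooth_on S g" and S: "open S" "z \<in> S"
  shows "wirt i (wirt_bar j (\<lambda>x. complex_of_real (g x))) z =
    Complex (second_deriv g z (axis i 1) (axis j 1) + second_deriv g z (axis i \<i>) (axis j \<i>))
      (second_deriv g z (axis i 1) (axis j \<i>) - second_deriv g z (axis i \<i>) (axis j 1)) / 4"
proof -
  let ?D = "\<lambda>v x. frechet_derivative g (at x) v"
  have 1: "(of_real (?D (axis j 1) x) + \<i> * of_real (?D (axis j \<i>) x)) / 2
      = wirt_bar j (\<lambda>x. complex_of_real (g x)) x" if x: "x \<in> S" for x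
  proof -
    have "((\<lambda>x. complex_of_real (g x)) has_derivative (\<lambda>v. of_real (?D v x))) (at x)"
      by (rule has_derivative_of_real) (rule smooth_on_frechet(2)[OF g x])
    then show ?thesis by (simp add: wirt_bar_def dir_deriv_eqI)
  qed
  have "((\<lambda>x. (complex_of_real (?D (axis j 1) x) + \<i> * of_real (?D (axis j \<i>) x)) / 2) has_derivative
     (\<lambda>u. (of_real (second_deriv g z u (axis j 1)) + \<i> * of_real (second_deriv g z u (axis j \<i>))) / 2)) (at z)"
    unfolding second_deriv_def
    by (intro bounded_linear.has_derivative[OF bounded_linear_divide] has_derivative_add has_derivative_mult_right has_derivative_of_real
        smooth_on_frechet(2)[OF smooth_on_frechet(1)[OF g] S(2)])
  note D' = dir_deriv_eqI[OF has_derivative_transform_within_open[OF this S 1]]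
  have D: "dir_deriv (wirt_bar j (\<lambda>x. complex_of_real (g x))) z u =
      (of_real (second_deriv g z u (axis j 1)) + \<i> * of_real (second_deriv g z u (axis j \<i>))) / 2" for u
    by (rule D')
  show ?thesis unfolding wirt_def D by (simp add: complex_eq_iff)
qed

lemma wirt_wirt_bar_add:
  fixes f g k :: "complex^2 \<Rightarrow> real"
  assumes "smooth_on S f" "smooth_on S g" "open S" "z \<in> S" "\<And>x. x \<in> S \<Longrightarrow> f x + g x = k x"
  shows "wirt i (wirt_bar j (\<lambda>x. complex_of_real (k x))) z
    = wirt i (wirt_bar j (\<lambda>x. complex_of_real (f x))) z + wirt i (wirt_bar j (\<lambda>x. complex_of_real (g x))) z"
proof -
  have k: "smooth_on S k"
    by (rule smooth_on_cong[OF assms(3) assms(5) smooth_on_add[OF assms(3,1,2)]])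
  have D: "second_deriv k z u v = second_deriv f z u v + second_deriv g z u v" for u v
    by (rule second_deriv_add[OF assms])
  show ?thesis
    unfolding wirt_wirt_bar_of_real[OF k assms(3,4)] wirt_wirt_bar_of_real[OF assms(1,3,4)]
      wirt_wirt_bar_of_real[OF assms(2,3,4)] D
    by (simp add: complex_eq_iff add_divide_distrib diff_divide_distrib)
qed

lemma wirt_wirt_bar_hermitian:
  fixes g :: "complex^2 \<Rightarrow> real"
  assumes "smooth_on S g" "open S" "z \<in> S"
  shows "wirt j (wirt_bar i (\<lambda>x. complex_of_real (g x))) z = cnj (wirt i (wirt_bar j (\<lambda>x. complex_of_real (g x))) z)"
  using second_deriv_symmetric[OF assms]
  by (simp add: wirt_wirt_bar_of_real[OF assms] complex_eq_iff)

lemma wirt_wirt_bar_Re_coordinate: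
  assumes g: "smooth_on UNIV g" and g': "\<And>t. (g has_real_derivative g' t) (at t)"
    and g'': "\<And>t. (g' has_real_derivative g'' t) (at t)"
  shows "wirt i (wirt_bar j (\<lambda>x. complex_of_real (g (Re (x $ 1))))) z
    = (if i = 1 \<and> j = 1 then of_real (g'' (Re (z $ 1)) / 4) else 0)"
  unfolding wirt_wirt_bar_of_real[OF smooth_on_linear_coordinate[OF bounded_linear_Re_nth g] open_UNIV UNIV_I]
    second_deriv_linear_coordinate[OF bounded_linear_Re_nth g' g'']
  by (simp add: complex_eq_iff axis_def)

text \<open>Replacing \<open>v\<close> by \<open>\<i> v\<close> separates the complex linear from the antilinear part of the form in \<open>v\<close>, and so recovers
the single coefficients.\<close>

lemma dz_dzbar_independent:
  fixes M N :: "complex^2^2"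
  assumes "\<And>v w. (\<Sum>i\<in>UNIV. \<Sum>j\<in>UNIV. M $ i $ j * dz_dzbar i j v w) = (\<Sum>i\<in>UNIV. \<Sum>j\<in>UNIV. N $ i $ j * dz_dzbar i j v w)"
  shows "M = N"
proof -
  have "M $ k $ l = N $ k $ l" for k l
  proof -
    have pol: "(\<Sum>i\<in>UNIV. \<Sum>j\<in>UNIV. M $ i $ j * dz_dzbar i j (axis k 1) (axis l 1))
       - \<i> * (\<Sum>i\<in>UNIV. \<Sum>j\<in>UNIV. M $ i $ j * dz_dzbar i j (axis k \<i>) (axis l 1)) = 2 * M $ k $ l"
      for M :: "complex^2^2"
      using exhaust_2[of k] exhaust_2[of l]
      by (elim disjE; simp add: sum_2 dz_dzbar_def axis_def algebra_simps)
    have "2 * M $ k $ l = 2 * N $ k $ l" unfolding pol[symmetric] assms by (rule refl)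
    then show ?thesis by simp
  qed
  then show ?thesis by (simp add: vec_eq_iff)
qed

lemma torus_pt_eq_imp_lattice:
  assumes "torus_pt z = torus_pt z'"
  obtains l where "l \<in> lattice" "z = z' + l"
proof -
  have "(0 :: complex^2) \<in> lattice" by (simp add: lattice_def)
  then have "z \<in> torus_pt z" by (force simp: torus_pt_def)
  then have "z \<in> torus_pt z'" using assms by simp
  then show ?thesis using that by (auto simp: torus_pt_def)
qed

lemma inv_triv_in_fibre:
  assumes "holomorphic_line_bundle L" "a \<in> index L" "p \<in> chart L a"
  shows "inv_into (fibre L p) (triv L a) 1 \<in> fibre L p"
    and "triv L a (inv_into (fibre L p) (triv L a) 1) = 1"
proof -
  have "triv L a ` fibre L p = UNIV"
    using assms by (auto simp: holomorphic_line_bundle_def bij_betw_def)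
  then show "inv_into (fibre L p) (triv L a) 1 \<in> fibre L p"
    "triv L a (inv_into (fibre L p) (triv L a) 1) = 1"
    by (auto intro: inv_into_into f_inv_into_f)
qed

lemma smooth_ln_local_weight:
  assumes "hermitian_metric L h" "a \<in> index L" "open (torus_pt -` chart L a)"
  shows "smooth_on (torus_pt -` chart L a) (\<lambda>z. ln (local_weight L h a z))"
  by (rule smooth_on_compose[OF assms(3) _ smooth_on_ln])
    (use assms(1,2) in \<open>auto simp: hermitian_metric_def\<close>)

text \<open>In a trivialisation the coefficients form the complex Hessian of a real function, which is Hermitian because
second derivatives commute.\<close>

lemma curvature_hermitian:
  fixes L :: "('e, 'a) line_bundle"
  assumes L: "holomorphic_line_bundle L" and h: "hermitian_metric L h"
    and F: "has_chern_curvature L h (\<lambda>z v w. \<i> * form11 F z v w)"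
  shows "F z $ j $ i = cnj (F z $ i $ j)"
proof -
  have "torus_pt z \<in> (\<Union>a\<in>index L. chart L a)"
    using L by (auto simp: holomorphic_line_bundle_def torus_def)
  then obtain a where a: "a \<in> index L" "z \<in> torus_pt -` chart L a" by auto
  then have op: "open (torus_pt -` chart L a)"
    using L by (auto simp: holomorphic_line_bundle_def torus_open_def)
  let ?P = "\<chi> i j. wirt i (wirt_bar j (\<lambda>z. complex_of_real (ln (local_weight L h a z)))) z"
  have "F z = ?P"
  proof (rule dz_dzbar_independent)
    fix v w
    have "\<i> * form11 F z v w = - (\<Sum>i\<in>UNIV. \<Sum>j\<in>UNIV. ?P $ i $ j * dz_dzbar i j v w)"
      using F a by (simp add: has_chern_curvature_def)
    then show "(\<Sum>i\<in>UNIV. \<Sum>j\<in>UNIV. F z $ i $ j * dz_dzbar i j v w)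
        = (\<Sum>i\<in>UNIV. \<Sum>j\<in>UNIV. ?P $ i $ j * dz_dzbar i j v w)"
      by (simp add: form11_def mult.assoc[symmetric])
  qed
  then show ?thesis
    by (simp only: vec_lambda_beta) (rule wirt_wirt_bar_hermitian[OF smooth_ln_local_weight[OF h a(1) op] op a(2)])
qed

text \<open>The factor depends on a representative in \<open>\<complex>\<^sup>2\<close> of the base point; periodicity of \<open>\<rho>\<close> makes the choice irrelevant.\<close>

lemma conformal_change_of_metric:
  fixes L :: "('e, 'a) line_bundle" and \<rho> :: "real \<Rightarrow> real"
  assumes L: "holomorphic_line_bundle L" and h0: "hermitian_metric L h\<^sub>0"
    and \<rho>: "smooth_on UNIV \<rho>" "\<And>t. \<rho> (t + 1) = \<rho> t"
  obtains h where "hermitian_metric L h"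
    "\<And>a z. a \<in> index L \<Longrightarrow> z \<in> torus_pt -` chart L a \<Longrightarrow>
      local_weight L h a z = local_weight L h\<^sub>0 a z * exp (\<rho> (Re (z $ 1)))"
proof -
  define h where "h e = h\<^sub>0 e * exp (\<rho> (Re ((SOME z. torus_pt z = proj L e) $ 1)))" for e
  have h: "h e = h\<^sub>0 e * exp (\<rho> (Re (z $ 1)))" if "e \<in> fibre L (torus_pt z)" for e z
  proof -
    let ?z = "SOME z. torus_pt z = proj L e"
    have pe: "torus_pt z = proj L e" using that by (simp add: fibre_def)
    have "torus_pt ?z = proj L e" by (rule someI[of _ z]) (rule pe)
    then obtain l where l: "l \<in> lattice" "?z = z + l"
      using pe torus_pt_eq_imp_lattice[of ?z z] by auto
    obtain n where "Re (l $ 1) = of_int n" using l(1) unfolding lattice_def by (auto elim: Ints_cases)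
    then have "\<rho> (Re (?z $ 1)) = \<rho> (Re (z $ 1))" unfolding l(2) using periodic_of_int[of \<rho>] \<rho>(2) by simp
    then show ?thesis by (simp add: h_def)
  qed
  have w: "local_weight L h a z = local_weight L h\<^sub>0 a z * exp (\<rho> (Re (z $ 1)))"
    if "a \<in> index L" "z \<in> torus_pt -` chart L a" for a z
    using h[OF inv_triv_in_fibre(1)[OF L that(1)]] that(2) by (simp add: local_weight_def)
  have "hermitian_metric L h"
    unfolding hermitian_metric_def
  proof (intro ballI conjI)
    fix a assume a: "a \<in> index L"
    let ?S = "torus_pt -` chart L a"
    have op: "open ?S" using L a by (auto simp: holomorphic_line_bundle_def torus_open_def)
    have 1: "smooth_on ?S (local_weight L h\<^sub>0 a)" using h0 a by (simp add: hermitian_metric_def)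
    have "smooth_on ?S (\<lambda>z. Re (z $ 1))" by (rule smooth_on_bounded_linear[OF bounded_linear_Re_nth op])
    from smooth_on_compose[OF op smooth_on_compose[OF op this \<rho>(1)] smooth_on_exp]
    have 2: "smooth_on ?S (\<lambda>z. exp (\<rho> (Re (z $ 1))))" by simp
    show "smooth_on ?S (local_weight L h a)"
      by (rule smooth_on_cong[OF op _ smooth_on_mult[OF op 1 2]]) (use w a in auto)
    fix z assume z: "z \<in> ?S"
    show "local_weight L h a z > 0"
      using w[OF a z] h0 a z by (auto simp: hermitian_metric_def)
    fix e assume e: "e \<in> fibre L (torus_pt z)"
    have "h\<^sub>0 e = local_weight L h\<^sub>0 a z * (cmod (triv L a e))\<^sup>2"
      using h0 a z e by (auto simp: hermitian_metric_def)
    then show "h e = local_weight L h a z * (cmod (triv L a e))\<^sup>2"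
      using h[OF e] w[OF a z] by simp
  qed
  then show ?thesis using w that by blast
qed

text \<open>The logarithm of the weight changes by the global function \<open>\<rho>(Re z\<^sub>1)\<close>, whose complex Hessian has the single
entry \<open>\<rho>''/4\<close>.\<close>

lemma curvature_of_conformal_change:
  fixes L :: "('e, 'a) line_bundle" and \<rho> \<rho>' \<rho>'' :: "real \<Rightarrow> real"
  assumes L: "holomorphic_line_bundle L" and h0: "hermitian_metric L h\<^sub>0"
    and F0: "has_chern_curvature L h\<^sub>0 (\<lambda>z v w. \<i> * form11 F\<^sub>0 z v w)"
    and \<rho>: "smooth_on UNIV \<rho>" "\<And>t. \<rho> (t + 1) = \<rho> t"
    and \<rho>': "\<And>t. (\<rho> has_real_derivative \<rho>' t) (at t)" "\<And>t. (\<rho>' has_real_derivative \<rho>'' t) (at t)"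
    and F: "\<And>z i j. F z $ i $ j = F\<^sub>0 z $ i $ j + (if i = 1 \<and> j = 1 then of_real (\<rho>'' (Re (z $ 1)) / 4) else 0)"
  obtains h where "hermitian_metric L h" "has_chern_curvature L h (\<lambda>z v w. \<i> * form11 F z v w)"
proof -
  obtain h where h: "hermitian_metric L h"
    and w: "\<And>a z. a \<in> index L \<Longrightarrow> z \<in> torus_pt -` chart L a \<Longrightarrow>
      local_weight L h a z = local_weight L h\<^sub>0 a z * exp (\<rho> (Re (z $ 1)))"
    using conformal_change_of_metric[OF L h0 \<rho>] by blast
  have "has_chern_curvature L h (\<lambda>z v w. \<i> * form11 F z v w)"
    unfolding has_chern_curvature_def
  proof (intro ballI allI)
    fix a z v w'
    assume a: "a \<in> index L" and z: "z \<in> torus_pt -` chart L a"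
    let ?S = "torus_pt -` chart L a"
    have op: "open ?S" using L a by (auto simp: holomorphic_line_bundle_def torus_open_def)
    let ?P = "\<lambda>g i j. wirt i (wirt_bar j (\<lambda>z. complex_of_real (g z))) z"
    let ?p = "\<lambda>z. ln (local_weight L h\<^sub>0 a z)" and ?g = "\<lambda>z. ln (local_weight L h a z)"
    let ?r = "\<lambda>z::complex^2. \<rho> (Re (z $ 1))"
    have s0: "smooth_on ?S ?p" by (rule smooth_ln_local_weight[OF h0 a op])
    have sr: "smooth_on ?S ?r"
      using smooth_on_compose[OF op smooth_on_bounded_linear[OF bounded_linear_Re_nth op] \<rho>(1)] by simp
    have g: "?p x + ?r x = ?g x" if "x \<in> ?S" for x
    proof -
      have "local_weight L h\<^sub>0 a x > 0" using h0 a that by (auto simp: hermitian_metric_def)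
      then show ?thesis using w[OF a that] by (simp add: ln_mult)
    qed
    have P: "?P ?g i j = ?P ?p i j + ?P ?r i j" for i j
      by (rule wirt_wirt_bar_add[OF s0 sr op z g])
    have 0: "\<i> * form11 F\<^sub>0 z v w' = - (\<Sum>i\<in>UNIV. \<Sum>j\<in>UNIV. ?P ?p i j * dz_dzbar i j v w')"
      using F0 a z by (simp add: has_chern_curvature_def)
    have "\<i> * form11 F z v w' = \<i> * form11 F\<^sub>0 z v w' - (\<Sum>i\<in>UNIV. \<Sum>j\<in>UNIV. ?P ?r i j * dz_dzbar i j v w')"
      unfolding form11_def F wirt_wirt_bar_Re_coordinate[OF \<rho>(1) \<rho>']
      by (simp add: sum_2 algebra_simps)
    also have "\<dots> = - (\<Sum>i\<in>UNIV. \<Sum>j\<in>UNIV. ?P ?g i j * dz_dzbar i j v w')"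
      unfolding 0 P by (simp add: sum.distrib algebra_simps)
    finally show "\<i> * form11 F z v w' = - (\<Sum>i\<in>UNIV. \<Sum>j\<in>UNIV. ?P ?g i j * dz_dzbar i j v w')" .
  qed
  with h show ?thesis using that by blast
qed

section \<open>The equations for separated data\<close>

lemma contraction_2:
  assumes "det G \<noteq> 0"
  shows "contraction G F = (G $ 2 $ 2 * F $ 1 $ 1 - G $ 1 $ 2 * F $ 1 $ 2 - G $ 2 $ 1 * F $ 2 $ 1
    + G $ 1 $ 1 * F $ 2 $ 2) / det G"
  by (simp add: contraction_def sum_2 matrix_inv_2[OF assms] add_divide_distrib diff_divide_distrib)

text \<open>On the chosen real basis, the square of a (1,1)-form is 8 times the determinant of its coefficients.\<close>

lemma top_quotient_form11: "top_quotient (form11 F) (form11 G) z = det (F z) / det (G z)"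
proof -
  have "wedge22 (form11 F) (form11 F) z (axis 1 1) (axis 1 \<i>) (axis 2 1) (axis 2 \<i>) = 8 * det (F z)" for F
    by (simp add: wedge22_def form11_def sum_2 dz_dzbar_def axis_def det_2 algebra_simps)
  then show ?thesis by (simp add: top_quotient_def)
qed

lemma separated_potential_exists:
  fixes A :: "real \<Rightarrow> real"
  assumes \<kappa>: "\<kappa> \<ge> 0" and A: "smooth_on UNIV A" "\<And>t. A (t + 1) = A t"
  obtains W V X U \<psi> where
    "separated_potential W V (\<lambda>x. \<kappa> * (1 - 1 / W x) - 4 * (A x - integral {0..1} A)) X U \<psi>"
proof -
  define B where "B x = 4 * (A x - integral {0..1} A)" for x
  have "smooth_on UNIV (\<lambda>x. 4 * (A x + - integral {0..1} A))"
    by (rule smooth_on_mult[OF open_UNIV smooth_on_const[OF open_UNIV]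
        smooth_on_add[OF open_UNIV A(1) smooth_on_const[OF open_UNIV]]])
  then have sB: "smooth_on UNIV B" by (simp add: B_def[abs_def])
  have Bp: "B (x + 1) = B x" for x by (simp add: B_def A(2))
  have "A integrable_on {0..1}"
    using smooth_on_frechet(3)[OF A(1)] continuous_on_subset by (intro integrable_continuous_real) blast
  then have "((\<lambda>x. 4 * (A x - integral {0..1} A)) has_integral 4 * (integral {0..1} A - integral {0..1} A)) {0..1}"
    using has_integral_const_real[of "integral {0..1} A" 0 1]
    by (intro has_integral_mult_right has_integral_diff integrable_integral) auto
  then have "integral {0..1} B = 0"
    by (simp add: B_def[abs_def] has_integral_iff)
  then obtain W V where W: "\<And>x. W x > 0" "\<And>x. W (x + 1) = W x" "\<And>x. (W has_real_derivative V x) (at x)"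
    "\<And>x. (V has_real_derivative \<kappa> * (1 - 1 / W x) - B x) (at x)" "integral {0..1} (\<lambda>x. 1 / W x) = 1"
    using periodic_profile_exists[of \<kappa> B] \<kappa> Bp smooth_on_frechet(3)[OF sB] by metis
  have sW: "smooth_on UNIV W" by (rule smooth_on_singular_ODE[OF sB W(1,3,4)])
  obtain X U \<psi> where
    "\<And>x. (U has_real_derivative 1 / W x) (at x)" "\<And>x. X (U x) = x" "\<And>y. U (X y) = y"
    "\<And>y. (X has_real_derivative W (X y)) (at y)" "\<And>y. X (y + 1) = X y + 1"
    "\<And>y. (\<psi> has_real_derivative X y - y) (at y)" "\<And>y. \<psi> (y + 1) = \<psi> y"
    "smooth_on UNIV X" "smooth_on UNIV \<psi>"
    by (rule inverse_profile[OF W(1,2) sW W(5)]) (rule that)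
  then have "separated_potential W V (\<lambda>x. \<kappa> * (1 - 1 / W x) - 4 * (A x - integral {0..1} A)) X U \<psi>"
    using W sW by unfold_locales (simp_all add: B_def)
  then show ?thesis by (rule that)
qed

context separated_potential
begin

lemma det_pot_nonzero: "det (pot_matrix v z) \<noteq> 0"
  using w_pos[of z] by (simp add: det_pot_matrix_v)

lemma contraction_pot_matrix_v: "contraction (pot_matrix v z) F = F $ 1 $ 1 / of_real (w z) + F $ 2 $ 2"
  using w_pos[of z] by (simp add: contraction_2[OF det_pot_nonzero] det_pot_matrix_v pot_matrix_v field_simps)

lemma contraction2_pot_matrix_v:
  "contraction2 (pot_matrix v z) F = 4 * (F $ 1 $ 1 * F $ 2 $ 2 - F $ 1 $ 2 * F $ 2 $ 1) / of_real (w z)"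
proof -
  have inv: "matrix_inv (pot_matrix v z) $ 1 $ 1 = 1 / of_real (w z)" "matrix_inv (pot_matrix v z) $ 1 $ 2 = 0"
    "matrix_inv (pot_matrix v z) $ 2 $ 1 = 0" "matrix_inv (pot_matrix v z) $ 2 $ 2 = 1"
    using w_pos[of z] by (simp_all add: matrix_inv_2[OF det_pot_nonzero] det_pot_matrix_v pot_matrix_v)
  show ?thesis
    using w_pos[of z]
    by (simp add: contraction2_def contraction_pot_matrix_v sum_2 inv power2_eq_square field_simps)
qed

text \<open>The curvature matrix of the metric \<open>exp (4 k \<psi>(Re z\<^sub>1)) h\<^sub>0\<close> if that of \<open>h\<^sub>0\<close> is \<open>F\<^sub>0\<close>, because \<open>\<psi>'' = w - 1\<close>.\<close>

definition twisted_curvature :: "real \<Rightarrow> complex^2^2 \<Rightarrow> complex^2 \<Rightarrow> complex^2^2" where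
  "twisted_curvature k F\<^sub>0 z = (\<chi> i j. F\<^sub>0 $ i $ j + (if i = 1 \<and> j = 1 then of_real (k * (w z - 1)) else 0))"

lemma metric_with_twisted_curvature:
  fixes L :: "('e, 'a) line_bundle"
  assumes L: "holomorphic_line_bundle L" and h0: "hermitian_metric L h\<^sub>0"
    and F0: "has_chern_curvature L h\<^sub>0 (\<lambda>z v w. \<i> * form11 (\<lambda>_. F\<^sub>0) z v w)"
  obtains h where "hermitian_metric L h"
    "has_chern_curvature L h (\<lambda>z v w. \<i> * form11 (twisted_curvature k F\<^sub>0) z v w)"
proof (rule curvature_of_conformal_change[OF L h0 F0, where \<rho> = "\<lambda>t. 4 * k * \<psi> t"
      and \<rho>' = "\<lambda>t. 4 * k * (X t - t)" and \<rho>'' = "\<lambda>t. 4 * k * (W (X t) - 1)"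
      and F = "twisted_curvature k F\<^sub>0"])
  show "smooth_on UNIV (\<lambda>t. 4 * k * \<psi> t)"
    by (rule smooth_on_mult[OF open_UNIV smooth_on_const[OF open_UNIV] smooth_\<psi>])
  show "4 * k * \<psi> (t + 1) = 4 * k * \<psi> t" for t by (simp add: \<psi>_periodic)
  show "((\<lambda>t. 4 * k * \<psi> t) has_real_derivative 4 * k * (X t - t)) (at t)" for t
    by (auto intro!: derivative_eq_intros \<psi>_deriv)
  show "((\<lambda>t. 4 * k * (X t - t)) has_real_derivative 4 * k * (W (X t) - 1)) (at t)" for t
    by (auto intro!: derivative_eq_intros X_deriv)
qed (use that in \<open>auto simp: twisted_curvature_def w_def\<close>)

lemma twisted_curvature_simps:
  "twisted_curvature k F\<^sub>0 z $ 1 $ 1 = F\<^sub>0 $ 1 $ 1 + of_real (k * (w z - 1))"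
  "twisted_curvature k F\<^sub>0 z $ 1 $ 2 = F\<^sub>0 $ 1 $ 2"
  "twisted_curvature k F\<^sub>0 z $ 2 $ 1 = F\<^sub>0 $ 2 $ 1"
  "twisted_curvature k F\<^sub>0 z $ 2 $ 2 = F\<^sub>0 $ 2 $ 2"
  by (simp_all add: twisted_curvature_def)

text \<open>For the factor \<open>k = a\<close> the entry \<open>F\<^sub>1\<^sub>1\<close> becomes \<open>a w\<close>, so \<open>w\<close> drops out of the trace.\<close>

lemma large_radius_terms:
  assumes F0: "F\<^sub>0 $ 1 $ 1 = of_real a" "F\<^sub>0 $ 2 $ 2 = of_real d" "F\<^sub>0 $ 1 $ 2 * F\<^sub>0 $ 2 $ 1 = of_real n"
  shows "contraction (pot_matrix v z) (twisted_curvature a F\<^sub>0 z) = of_real (a + d)"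
    and "contraction2 (pot_matrix v z) (twisted_curvature a F\<^sub>0 z) = of_real (4 * (a * d - n / w z))"
proof -
  have F11: "twisted_curvature a F\<^sub>0 z $ 1 $ 1 = of_real (a * w z)"
    by (simp add: twisted_curvature_simps F0 algebra_simps)
  note F = F11 twisted_curvature_simps(2-4) F0
  show "contraction (pot_matrix v z) (twisted_curvature a F\<^sub>0 z) = of_real (a + d)"
    using w_pos[of z] by (simp add: contraction_pot_matrix_v F)
  show "contraction2 (pot_matrix v z) (twisted_curvature a F\<^sub>0 z) = of_real (4 * (a * d - n / w z))"
    using w_pos[of z] by (simp add: contraction2_pot_matrix_v F field_simps)
qed

text \<open>The condition \<open>(d w + F\<^sub>1\<^sub>1) / (d F\<^sub>1\<^sub>1 - n) = (a + d)/D\<close> is linear in \<open>F\<^sub>1\<^sub>1\<close> and \<open>w\<close>, and \<open>F\<^sub>1\<^sub>1 = a\<close> solves it for \<open>w = 1\<close>. The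
factor \<open>k\<close> is the slope of its solution \<open>F\<^sub>1\<^sub>1\<close> as a function of \<open>w\<close>.\<close>

lemma small_radius_terms:
  assumes F0: "F\<^sub>0 $ 1 $ 1 = of_real a" "F\<^sub>0 $ 2 $ 2 = of_real d" "F\<^sub>0 $ 1 $ 2 * F\<^sub>0 $ 2 $ 1 = of_real n"
    and n: "n \<ge> 0" and D: "D = a * d - n" "D > 0"
  defines "F \<equiv> twisted_curvature (d * D / (d\<^sup>2 + n)) F\<^sub>0"
  shows "det (F z) \<noteq> 0"
    and "contraction (F z) (pot_matrix v z) = of_real ((a + d) / D)"
    and "top_quotient (form11 F) (form11 (pot_matrix v)) z = of_real (D * (n / w z + d\<^sup>2) / (d\<^sup>2 + n))"
proof -
  let ?w = "w z"
  have d: "d \<noteq> 0" using D n by auto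
  have s: "d\<^sup>2 + n > 0" using d n by (simp add: add_pos_nonneg)
  define q where "q = a + d * D / (d\<^sup>2 + n) * (?w - 1)"
  have q: "q * d - n = D * (n + d\<^sup>2 * ?w) / (d\<^sup>2 + n)"
    using s unfolding q_def D(1) by (simp add: divide_simps power2_eq_square) (simp add: algebra_simps)
  have detpos: "D * (n + d\<^sup>2 * ?w) / (d\<^sup>2 + n) > 0"
    using s D(2) d n w_pos[of z] by (auto intro!: divide_pos_pos mult_pos_pos add_nonneg_pos)
  have F11: "F z $ 1 $ 1 = of_real q" by (simp add: F_def twisted_curvature_simps F0 q_def)
  have F: "F z $ 2 $ 2 = of_real d" "F z $ 1 $ 2 * F z $ 2 $ 1 = of_real n"
    by (simp_all add: F_def twisted_curvature_simps F0)
  have "det (F z) = of_real (q * d - n)" by (simp add: det_2 F11 F)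
  then have det: "det (F z) = of_real (D * (n + d\<^sup>2 * ?w) / (d\<^sup>2 + n))" unfolding q .
  show nz: "det (F z) \<noteq> 0" unfolding det of_real_eq_0_iff using detpos by linarith
  have "contraction (F z) (pot_matrix v z) = of_real ((d * ?w + q) / (D * (n + d\<^sup>2 * ?w) / (d\<^sup>2 + n)))"
    unfolding contraction_2[OF nz] det by (simp add: pot_matrix_v F11 F)
  also have "d * ?w + q = (a + d) / D * (D * (n + d\<^sup>2 * ?w) / (d\<^sup>2 + n))"
    using s D(2) unfolding q_def by (simp add: divide_simps) (simp add: D(1) algebra_simps power2_eq_square)
  also have "\<dots> / (D * (n + d\<^sup>2 * ?w) / (d\<^sup>2 + n)) = (a + d) / D"
    using detpos by (intro nonzero_mult_div_cancel_right) linarith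
  finally show "contraction (F z) (pot_matrix v z) = of_real ((a + d) / D)" .
  have "D * (n + d\<^sup>2 * ?w) / (d\<^sup>2 + n) / ?w = D * (n / ?w + d\<^sup>2) / (d\<^sup>2 + n)"
    using w_pos[of z] by (simp add: field_simps)
  then show "top_quotient (form11 F) (form11 (pot_matrix v)) z = of_real (D * (n / w z + d\<^sup>2) / (d\<^sup>2 + n))"
    unfolding top_quotient_form11 det det_pot_matrix_v of_real_divide[symmetric] by simp
qed

end

theorem theorem16:
  fixes L :: "('e, 'a) line_bundle"
    and h\<^sub>0 :: "'e \<Rightarrow> real"
    and F\<^sub>0 :: "complex^2^2"
    and \<alpha> :: real
  assumes "holomorphic_line_bundle L"
    and "hermitian_metric L h\<^sub>0"
    and "has_chern_curvature L h\<^sub>0 (\<lambda>z v w. \<i> * form11 (\<lambda>_. F\<^sub>0) z v w)"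
    and "\<alpha> > 0"
  shows
    "(\<forall>(A :: real \<Rightarrow> real) (c :: real).
        c = Re (trace F\<^sub>0) \<and>
        smooth_on UNIV A \<and> (\<forall>t. A (t + 1) = A t) \<and>
        integral {0..1} A = \<alpha> * (4 * Re (det F\<^sub>0) + c\<^sup>2 / 2)
        \<longrightarrow>
        (\<exists>(v :: real^2 \<Rightarrow> real) \<omega> h F (f :: real \<Rightarrow> real).
           invariant_potential v \<and> \<omega> = form11 (pot_matrix v) \<and>
           kahler_form \<omega> \<and> U1_invariant \<omega> \<and> cohomologous \<omega> flat_form \<and>
           hermitian_metric L h \<and>
           has_chern_curvature L h (\<lambda>z v w. \<i> * form11 F z v w) \<and>
           (\<forall>x. f (grad (legendre v) x $ 1) = A (x $ 1)) \<and>
           (\<forall>z. contraction (pot_matrix v z) (F z) = complex_of_real c) \<and>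
           (\<forall>z. complex_of_real (scalar_curvature v (re_vec z))
                 + complex_of_real \<alpha> *
                   (contraction2 (pot_matrix v z) (F z) + (complex_of_real c)\<^sup>2 / 2)
                 = complex_of_real (f (re_vec z $ 1))))) \<and>
     (Re (det F\<^sub>0) > 0 \<longrightarrow>
      (\<forall>(A :: real \<Rightarrow> real) (c :: real).
        c = Re (trace F\<^sub>0) / Re (det F\<^sub>0) \<and>
        smooth_on UNIV A \<and> (\<forall>t. A (t + 1) = A t) \<and>
        integral {0..1} A = - \<alpha> * Re (det F\<^sub>0)
        \<longrightarrow>
        (\<exists>(v :: real^2 \<Rightarrow> real) \<omega> h F (f :: real \<Rightarrow> real).
           invariant_potential v \<and> \<omega> = form11 (pot_matrix v) \<and>
           kahler_form \<omega> \<and> U1_invariant \<omega> \<and> cohomologous \<omega> flat_form \<and>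
           hermitian_metric L h \<and>
           has_chern_curvature L h (\<lambda>z v w. \<i> * form11 F z v w) \<and>
           (\<forall>x. f (grad (legendre v) x $ 1) = A (x $ 1)) \<and>
           (\<forall>z. det (F z) \<noteq> 0) \<and>
           (\<forall>z. contraction (F z) (pot_matrix v z) = complex_of_real c) \<and>
           (\<forall>z. complex_of_real (scalar_curvature v (re_vec z))
                 - complex_of_real \<alpha> * top_quotient (form11 F) \<omega> z
                 = complex_of_real (f (re_vec z $ 1))))))"
proof -
  \<comment> \<open>The curvature matrix is Hermitian with diagonal entries \<open>a\<close> and \<open>d\<close>, and it enters the equations only through \<open>a\<close>, \<open>d\<close>
and the squared modulus \<open>n\<close> of the off-diagonal entry.\<close>
  define a d n D where "a = Re (F\<^sub>0 $ 1 $ 1)" and "d = Re (F\<^sub>0 $ 2 $ 2)"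
    and "n = (cmod (F\<^sub>0 $ 1 $ 2))\<^sup>2" and "D = a * d - n"
  have herm: "F\<^sub>0 $ j $ i = cnj (F\<^sub>0 $ i $ j)" for i j
    by (rule curvature_hermitian[OF assms(1,2), where F = "\<lambda>_. F\<^sub>0"]) (rule assms(3))
  have F0: "F\<^sub>0 $ 1 $ 1 = of_real a" "F\<^sub>0 $ 2 $ 2 = of_real d" "F\<^sub>0 $ 1 $ 2 * F\<^sub>0 $ 2 $ 1 = of_real n"
  proof -
    show "F\<^sub>0 $ 1 $ 1 = of_real a"
      unfolding a_def using arg_cong[OF herm[of 1 1], of Im] by (simp add: complex_eq_iff)
    show "F\<^sub>0 $ 2 $ 2 = of_real d"
      unfolding d_def using arg_cong[OF herm[of 2 2], of Im] by (simp add: complex_eq_iff)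
    show "F\<^sub>0 $ 1 $ 2 * F\<^sub>0 $ 2 $ 1 = of_real n"
      unfolding n_def by (subst herm[of 2 1]) (rule complex_norm_square[symmetric])
  qed
  have n: "n \<ge> 0" by (simp add: n_def)
  have tr: "Re (trace F\<^sub>0) = a + d" by (simp add: trace_def sum_2 F0)
  have det: "Re (det F\<^sub>0) = D" by (simp add: det_2 F0 D_def)
  show ?thesis
    unfolding tr det
  proof (intro conjI allI impI; (elim conjE)?)
    fix A :: "real \<Rightarrow> real" and c :: real
    assume c: "c = a + d" and A: "smooth_on UNIV A" "\<forall>t. A (t + 1) = A t"
      and mean: "integral {0..1} A = \<alpha> * (4 * D + c\<^sup>2 / 2)"
    have "16 * \<alpha> * n \<ge> 0" using assms(4) n by simp
    then obtain W V X U \<psi> where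
      "separated_potential W V (\<lambda>x. 16 * \<alpha> * n * (1 - 1 / W x) - 4 * (A x - integral {0..1} A)) X U \<psi>"
      using separated_potential_exists[of "16 * \<alpha> * n" A] A by metis
    then interpret separated_potential W V "\<lambda>x. 16 * \<alpha> * n * (1 - 1 / W x) - 4 * (A x - integral {0..1} A)" X U \<psi> .
    obtain h where h: "hermitian_metric L h"
      "has_chern_curvature L h (\<lambda>z v w. \<i> * form11 (twisted_curvature a F\<^sub>0) z v w)"
      using metric_with_twisted_curvature[OF assms(1,2,3)] by blast
    note terms = large_radius_terms[OF F0]
    show "\<exists>v \<omega> h F f. invariant_potential v \<and> \<omega> = form11 (pot_matrix v) \<and>
           kahler_form \<omega> \<and> U1_invariant \<omega> \<and> cohomologous \<omega> flat_form \<and>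
           hermitian_metric L h \<and>
           has_chern_curvature L h (\<lambda>z v w. \<i> * form11 F z v w) \<and>
           (\<forall>x. f (grad (legendre v) x $ 1) = A (x $ 1)) \<and>
           (\<forall>z. contraction (pot_matrix v z) (F z) = complex_of_real c) \<and>
           (\<forall>z. complex_of_real (scalar_curvature v (re_vec z))
                 + complex_of_real \<alpha> *
                   (contraction2 (pot_matrix v z) (F z) + (complex_of_real c)\<^sup>2 / 2)
                 = complex_of_real (f (re_vec z $ 1)))"
    proof (intro exI conjI allI)
      show "A (X (grad (legendre v) x $ 1)) = A (x $ 1)" for x
        by (simp add: grad_legendre_v X_U)
      show "contraction (pot_matrix v z) (twisted_curvature a F\<^sub>0 z) = complex_of_real c" for z
        by (simp add: terms c)
      fix z
      have w: "w z = W (X (re_vec z $ 1))" by (simp add: w_def re_vec_def)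
      have "scalar_curvature v (re_vec z) + \<alpha> * (4 * (a * d - n / w z) + c\<^sup>2 / 2) = A (X (re_vec z $ 1))"
        unfolding scalar_curvature_v mean w D_def by (simp add: field_simps)
      from arg_cong[OF this, of complex_of_real] show "complex_of_real (scalar_curvature v (re_vec z))
          + complex_of_real \<alpha> * (contraction2 (pot_matrix v z) (twisted_curvature a F\<^sub>0 z) + (complex_of_real c)\<^sup>2 / 2)
          = complex_of_real (A (X (re_vec z $ 1)))"
        unfolding terms by simp
    qed (rule invariant_potential_v refl kahler_form_v U1_invariant_v cohomologous_v h)+
  next
    assume D: "D > 0"
    fix A :: "real \<Rightarrow> real" and c :: real
    assume c: "c = (a + d) / D" and A: "smooth_on UNIV A" "\<forall>t. A (t + 1) = A t"
      and mean: "integral {0..1} A = - \<alpha> * D"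
    define \<kappa> where "\<kappa> = 4 * \<alpha> * D * n / (d\<^sup>2 + n)"
    have "d \<noteq> 0" using D n by (auto simp: D_def)
    then have s: "d\<^sup>2 + n > 0" using n by (simp add: add_pos_nonneg)
    have "\<kappa> \<ge> 0" using assms(4) n D s by (simp add: \<kappa>_def)
    then obtain W V X U \<psi> where
      "separated_potential W V (\<lambda>x. \<kappa> * (1 - 1 / W x) - 4 * (A x - integral {0..1} A)) X U \<psi>"
      using separated_potential_exists[of \<kappa> A] A by metis
    then interpret separated_potential W V "\<lambda>x. \<kappa> * (1 - 1 / W x) - 4 * (A x - integral {0..1} A)" X U \<psi> .
    let ?F = "twisted_curvature (d * D / (d\<^sup>2 + n)) F\<^sub>0"
    obtain h where h: "hermitian_metric L h"
      "has_chern_curvature L h (\<lambda>z v w. \<i> * form11 ?F z v w)"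
      using metric_with_twisted_curvature[OF assms(1,2,3)] by blast
    note terms = small_radius_terms[OF F0 n D_def D]
    show "\<exists>v \<omega> h F f. invariant_potential v \<and> \<omega> = form11 (pot_matrix v) \<and>
           kahler_form \<omega> \<and> U1_invariant \<omega> \<and> cohomologous \<omega> flat_form \<and>
           hermitian_metric L h \<and>
           has_chern_curvature L h (\<lambda>z v w. \<i> * form11 F z v w) \<and>
           (\<forall>x. f (grad (legendre v) x $ 1) = A (x $ 1)) \<and>
           (\<forall>z. det (F z) \<noteq> 0) \<and>
           (\<forall>z. contraction (F z) (pot_matrix v z) = complex_of_real c) \<and>
           (\<forall>z. complex_of_real (scalar_curvature v (re_vec z))
                 - complex_of_real \<alpha> * top_quotient (form11 F) \<omega> z
                 = complex_of_real (f (re_vec z $ 1)))"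
    proof (intro exI conjI allI)
      show "A (X (grad (legendre v) x $ 1)) = A (x $ 1)" for x
        by (simp add: grad_legendre_v X_U)
      show "contraction (?F z) (pot_matrix v z) = complex_of_real c" for z
        by (simp only: terms c)
      fix z
      have w: "w z = W (X (re_vec z $ 1))" by (simp add: w_def re_vec_def)
      \<comment> \<open>The weights add up to 1, so the constant \<open>- \<alpha> D m\<close> from the scalar curvature and the constant \<open>- \<alpha> D e\<close> from
\<open>F\<^sup>2/\<omega>\<^sup>2\<close> together equal the mean of \<open>A\<close>.\<close>
      define m e where "m = n / (d\<^sup>2 + n)" and "e = d\<^sup>2 / (d\<^sup>2 + n)"
      have e: "e = 1 - m" using s by (simp add: m_def e_def field_simps)
      have \<kappa>: "\<kappa> = 4 * \<alpha> * D * m" by (simp add: \<kappa>_def m_def)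
      have q: "D * (n / w z + d\<^sup>2) / (d\<^sup>2 + n) = D * (m / w z + e)"
        by (simp add: m_def e_def add_divide_distrib distrib_left mult.commute)
      have "scalar_curvature v (re_vec z) - \<alpha> * (D * (n / w z + d\<^sup>2) / (d\<^sup>2 + n)) = A (X (re_vec z $ 1))"
        unfolding q unfolding scalar_curvature_v mean w \<kappa> e by (simp add: field_simps)
      from arg_cong[OF this, of complex_of_real] show "complex_of_real (scalar_curvature v (re_vec z))
          - complex_of_real \<alpha> * top_quotient (form11 ?F) (form11 (pot_matrix v)) z
          = complex_of_real (A (X (re_vec z $ 1)))"
        unfolding terms by simp
    qed (rule invariant_potential_v refl kahler_form_v U1_invariant_v cohomologous_v h terms(1))+
  qed
qed

end
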